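(* The variant of BMST in which the leader minimizes the bottleneck objective $\max_{e\in X\cup Y}c(e)$ (instead of $c(X\cup Y)$) while the follower keeps the sum objective $d(Y)$ can be solved exactly in polynomial time.
   Context: Setting: a finite connected undirected graph $G=(V,E)$, possibly with parallel edges, with $E$ partitioned into disjoint sets $E^\ell$ (leader's edges) and $E^f$ (follower's edges), cost functions $c,d\colon E\to\mathbb{R}_{\ge 0}$, and a fixed linear order $e_1,\dots,e_m$ of $E^f$ nondecreasing in $d$. A leader's choice is a cycle-free $X\subseteq E^\ell$, feasible if $(V,X\cup E^f)$ is connected. The follower's response $Y$ to $X$ is obtained greedily: start with $Y=\emptyset$ and for $i=1,\dots,m$ add $e_i$ if $X\cup Y\cup\{e_i\}$ is cycle-free; for feasible $X$, $X\cup Y$ is a spanning tree and $Y$ minimizes $\sum_{e\in Y}d(e)$ over all completions. The leader seeks a feasible $X$ minimizing $\max_{e\in X\cup Y}c(e)$. *)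

theory Defs
  imports Complex_Main "HOL-Computational_Algebra.Polynomial"
begin

section \<open>The bottleneck bilevel minimum spanning tree problem\<close>

text \<open>Undirected multigraphs: edges are abstract objects and \<open>ends e\<close> is the set of end points of
  \<open>e\<close>, so distinct edges may be parallel.\<close>

definition connected_by :: "('e \<Rightarrow> 'v set) \<Rightarrow> 'v set \<Rightarrow> 'e set \<Rightarrow> bool" where
  "connected_by ends V F \<longleftrightarrow>
     (\<forall>u\<in>V. \<forall>v\<in>V. (u, v) \<in> {(x, y). \<exists>e\<in>F. ends e = {x, y}}\<^sup>*)"

text \<open>A cycle runs through the distinct vertices \<open>vs\<close> along the distinct edges \<open>es\<close>; two parallel
  edges form a cycle of length 2.\<close>

definition is_cycle :: "('e \<Rightarrow> 'v set) \<Rightarrow> 'v list \<Rightarrow> 'e list \<Rightarrow> bool" where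
  "is_cycle ends vs es \<longleftrightarrow>
     es \<noteq> [] \<and> length vs = length es \<and> distinct vs \<and> distinct es \<and>
     (\<forall>i < length es. ends (es ! i) = {vs ! i, vs ! (Suc i mod length es)})"

definition cycle_free :: "('e \<Rightarrow> 'v set) \<Rightarrow> 'e set \<Rightarrow> bool" where
  "cycle_free ends F \<longleftrightarrow> \<not> (\<exists>vs es. set es \<subseteq> F \<and> is_cycle ends vs es)"

record ('v, 'e) bmst =
  verts :: "'v set"
  leader_edges :: "'e set"
  follower_edges :: "'e set"
  ends :: "'e \<Rightarrow> 'v set"
  leader_cost :: "'e \<Rightarrow> real"
  follower_cost :: "'e \<Rightarrow> real"
  follower_order :: "'e list"

definition edges :: "('v, 'e) bmst \<Rightarrow> 'e set" where
  "edges I = leader_edges I \<union> follower_edges I"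

definition bmst_instance :: "('v, 'e) bmst \<Rightarrow> bool" where
  "bmst_instance I \<longleftrightarrow>
     finite (verts I) \<and> verts I \<noteq> {} \<and> finite (edges I) \<and>
     leader_edges I \<inter> follower_edges I = {} \<and>
     (\<forall>e\<in>edges I. ends I e \<subseteq> verts I \<and> card (ends I e) = 2) \<and>
     connected_by (ends I) (verts I) (edges I) \<and>
     (\<forall>e\<in>edges I. 0 \<le> leader_cost I e \<and> 0 \<le> follower_cost I e) \<and>
     distinct (follower_order I) \<and> set (follower_order I) = follower_edges I \<and>
     sorted (map (follower_cost I) (follower_order I))"

definition feasible_choice :: "('v, 'e) bmst \<Rightarrow> 'e set \<Rightarrow> bool" where
  "feasible_choice I X \<longleftrightarrow>
     X \<subseteq> leader_edges I \<and> cycle_free (ends I) X \<and>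
     connected_by (ends I) (verts I) (X \<union> follower_edges I)"

primrec greedy :: "('e \<Rightarrow> 'v set) \<Rightarrow> 'e set \<Rightarrow> 'e list \<Rightarrow> 'e set \<Rightarrow> 'e set" where
  "greedy en X [] Y = Y"
| "greedy en X (e # es) Y =
     greedy en X es (if cycle_free en (X \<union> Y \<union> {e}) then insert e Y else Y)"

definition response :: "('v, 'e) bmst \<Rightarrow> 'e set \<Rightarrow> 'e set" where
  "response I X = greedy (ends I) X (follower_order I) {}"

text \<open>The tree is empty only if there is a single vertex; its bottleneck is then taken to be 0.\<close>

definition bottleneck :: "('v, 'e) bmst \<Rightarrow> 'e set \<Rightarrow> real" where
  "bottleneck I X =
     (let T = X \<union> response I X in if T = {} then 0 else Max (leader_cost I ` T))"

definition optimal_choice :: "('v, 'e) bmst \<Rightarrow> 'e set \<Rightarrow> bool" where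
  "optimal_choice I X \<longleftrightarrow>
     feasible_choice I X \<and> (\<forall>X'. feasible_choice I X' \<longrightarrow> bottleneck I X \<le> bottleneck I X')"


section \<open>Polynomial time\<close>

text \<open>
  The model of computation is a random access machine presented as a structured while language.
  Natural-number cells admit addition, truncated subtraction and comparison; real cells, needed
  because edge costs are arbitrary reals, admit addition, subtraction and comparison. Every
  executed assignment and every evaluated test costs one step; expressions have constant size in a
  fixed program.

  The unit-cost measure is harmless: there is no multiplication, so after \<open>t\<close> steps the bit length
  of every number has grown by at most \<open>O(t)\<close>, and for rational inputs a run is simulated by a
  Turing machine in time polynomial in \<open>t\<close> and the input's bit length. There are no real
  literals, which could smuggle non-computable information into a program.
\<close>

type_synonym vname = string

record state =
  nvar :: "vname \<Rightarrow> nat"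
  narr :: "vname \<Rightarrow> nat \<Rightarrow> nat"
  rarr :: "vname \<Rightarrow> nat \<Rightarrow> real"

datatype nexp = Num nat | Var vname | Get vname nexp | Add nexp nexp | Sub nexp nexp

datatype rexp = RGet vname nexp | RAdd rexp rexp | RSub rexp rexp

datatype bexp = Leq nexp nexp | RLeq rexp rexp | Neg bexp | Conj bexp bexp

datatype com =
    Skip
  | Assign vname nexp
  | Put vname nexp nexp
  | RPut vname nexp rexp
  | Seq com com
  | Cond bexp com com
  | While bexp com

primrec nval :: "state \<Rightarrow> nexp \<Rightarrow> nat" where
  "nval s (Num k) = k"
| "nval s (Var x) = nvar s x"
| "nval s (Get a i) = narr s a (nval s i)"
| "nval s (Add i j) = nval s i + nval s j"
| "nval s (Sub i j) = nval s i - nval s j"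

primrec rval :: "state \<Rightarrow> rexp \<Rightarrow> real" where
  "rval s (RGet a i) = rarr s a (nval s i)"
| "rval s (RAdd q r) = rval s q + rval s r"
| "rval s (RSub q r) = rval s q - rval s r"

primrec bval :: "state \<Rightarrow> bexp \<Rightarrow> bool" where
  "bval s (Leq i j) \<longleftrightarrow> nval s i \<le> nval s j"
| "bval s (RLeq q r) \<longleftrightarrow> rval s q \<le> rval s r"
| "bval s (Neg b) \<longleftrightarrow> \<not> bval s b"
| "bval s (Conj b b') \<longleftrightarrow> bval s b \<and> bval s b'"

definition put :: "(vname \<Rightarrow> nat \<Rightarrow> 'a) \<Rightarrow> vname \<Rightarrow> nat \<Rightarrow> 'a \<Rightarrow> vname \<Rightarrow> nat \<Rightarrow> 'a" where
  "put m a i x = m(a := (m a)(i := x))"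

text \<open>\<open>runs p s t s'\<close>: started in \<open>s\<close>, program \<open>p\<close> halts in \<open>s'\<close> after \<open>t\<close> steps.\<close>

inductive runs :: "com \<Rightarrow> state \<Rightarrow> nat \<Rightarrow> state \<Rightarrow> bool" where
  Skip: "runs Skip s 1 s"
| Assign: "runs (Assign x i) s 1 (s\<lparr>nvar := (nvar s)(x := nval s i)\<rparr>)"
| Put: "runs (Put a i j) s 1 (s\<lparr>narr := put (narr s) a (nval s i) (nval s j)\<rparr>)"
| RPut: "runs (RPut a i r) s 1 (s\<lparr>rarr := put (rarr s) a (nval s i) (rval s r)\<rparr>)"
| Seq: "runs p s t s' \<Longrightarrow> runs q s' t' s'' \<Longrightarrow> runs (Seq p q) s (t + t') s''"
| CondTrue: "bval s b \<Longrightarrow> runs p s t s' \<Longrightarrow> runs (Cond b p q) s (Suc t) s'"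
| CondFalse: "\<not> bval s b \<Longrightarrow> runs q s t s' \<Longrightarrow> runs (Cond b p q) s (Suc t) s'"
| WhileFalse: "\<not> bval s b \<Longrightarrow> runs (While b p) s 1 s"
| WhileTrue: "bval s b \<Longrightarrow> runs p s t s' \<Longrightarrow> runs (While b p) s' t' s'' \<Longrightarrow>
    runs (While b p) s (Suc (t + t')) s''"

inductive_cases runs_elims:
  "runs Skip s t s'" "runs (Assign x i) s t s'" "runs (Put a i j) s t s'" "runs (RPut a i r) s t s'"
  "runs (Seq p q) s t s'" "runs (Cond b p q) s t s'"

inductive_cases runs_WhileE: "runs (While b p) s t s'"

lemma runs_deterministic: "runs p s t s' \<Longrightarrow> runs p s u s'' \<Longrightarrow> t = u \<and> s' = s''"
proof (induction arbitrary: u s'' rule: runs.induct)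
  case (Seq p s t s' q t' r)
  from Seq.prems show ?case by (elim runs_elims) (use Seq.IH in blast)
next
  case (CondTrue s b p t s' q)
  from CondTrue.prems show ?case by (elim runs_elims) (use CondTrue.IH CondTrue.hyps in blast)+
next
  case (CondFalse s b q t s' p)
  from CondFalse.prems show ?case by (elim runs_elims) (use CondFalse.IH CondFalse.hyps in blast)+
next
  case (WhileFalse s b p)
  from WhileFalse.prems show ?case by (rule runs_WhileE) (use WhileFalse.hyps in auto)
next
  case (WhileTrue s b p t s' t' r)
  from WhileTrue.prems show ?case
    by (rule runs_WhileE) (use WhileTrue.IH WhileTrue.hyps in blast)+
qed (auto elim: runs_elims)

text \<open>
  An algorithmic problem is given by its instances, their size, their encoding as initial states,
  the decoding of final states as answers, and the relation between instances and correct answers.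
\<close>

definition polynomial_time_solvable ::
  "'i set \<Rightarrow> ('i \<Rightarrow> nat) \<Rightarrow> ('i \<Rightarrow> state) \<Rightarrow> ('i \<Rightarrow> state \<Rightarrow> 'a) \<Rightarrow> ('i \<Rightarrow> 'a \<Rightarrow> bool) \<Rightarrow> bool" where
  "polynomial_time_solvable insts sz enc dec correct \<longleftrightarrow>
     (\<exists>(prog :: com) (b :: nat poly). \<forall>I\<in>insts. \<exists>t s.
        runs prog (enc I) t s \<and> t \<le> poly b (sz I) \<and> correct I (dec I s))"


section \<open>Input and output format\<close>

text \<open>As machine input, the vertices and the edges are numbered from 0.\<close>

definition bmst_inputs :: "(nat, nat) bmst set" where
  "bmst_inputs = {I. bmst_instance I \<and>
     verts I = {0..<card (verts I)} \<and> edges I = {0..<card (edges I)}}"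

definition bmst_size :: "(nat, nat) bmst \<Rightarrow> nat" where
  "bmst_size I = card (verts I) + card (edges I)"

text \<open>All cells not carrying input are 0; in particular the functions of an instance are exposed
  only on its edges.\<close>

definition tabulate :: "nat \<Rightarrow> (nat \<Rightarrow> 'a::zero) \<Rightarrow> nat \<Rightarrow> 'a" where
  "tabulate k f i = (if i < k then f i else 0)"

definition bmst_encode :: "(nat, nat) bmst \<Rightarrow> state" where
  "bmst_encode I = (let n = card (verts I); k = card (edges I); m = length (follower_order I) in
     \<lparr>nvar = (\<lambda>_. 0)(''n'' := n, ''k'' := k, ''m'' := m),
      narr = (\<lambda>_ _. 0)
        (''u'' := tabulate k (\<lambda>e. Min (ends I e)),
         ''v'' := tabulate k (\<lambda>e. Max (ends I e)),
         ''leader'' := tabulate k (\<lambda>e. if e \<in> leader_edges I then 1 else 0),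
         ''order'' := tabulate m (\<lambda>i. follower_order I ! i)),
      rarr = (\<lambda>_ _. 0)
        (''c'' := tabulate k (leader_cost I),
         ''d'' := tabulate k (follower_cost I))\<rparr>)"

definition bmst_decode :: "(nat, nat) bmst \<Rightarrow> state \<Rightarrow> nat set" where
  "bmst_decode I s = {e \<in> edges I. narr s ''X'' e \<noteq> 0}"

end

theory Submission imports Defs begin

text \<open>The follower accepts an edge iff its ends are not yet connected by \<open>X\<close> and the earlier edges of
  the order. So the more vertices \<open>X\<close> connects, the fewer edges the follower picks, and among all
  choices of leader's edges of cost at most \<open>c t\<close> a maximal forest of such edges is best. An optimal
  bottleneck value is the cost \<open>c t\<close> of some edge \<open>t\<close>, hence it suffices to compute such a maximal
  forest and the follower's response for every edge \<open>t\<close>, and to keep the forest for a cheapest \<open>t\<close>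
  for which the forest is feasible and the response costs at most \<open>c t\<close>.\<close>

section \<open>Forests and connectivity\<close>

text \<open>The bottleneck objective is what makes maximality free: below a threshold, extra
  leader's edges do not raise the maximum, whereas in a sum each of them would have to be paid for.
  A maximal forest below the threshold need not contain a given choice \<open>X\<close>, so
  responses cannot be compared through inclusion of edge sets; the comparison is made between
  connectivity relations, which all maximal forests of the same edges share. The threshold edge
  ranges over all edges, since the maximum may sit on a follower's edge. An achievable threshold
  only bounds the bottleneck of its forest from above. This suffices, because as soon as there is an
  edge, the bottleneck of every feasible choice is itself the cost of an achievable threshold. The
  labels serve twice: they decide each greedy step, and after the follower's turn they decide
  feasibility, because the greedy completion has the same components as the leader's forest with all
  follower's edges.\<close>

definition conn :: "('e \<Rightarrow> 'v set) \<Rightarrow> 'e set \<Rightarrow> ('v \<times> 'v) set" where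
  "conn en F = {(x, y). \<exists>e\<in>F. en e = {x, y}}\<^sup>*"

lemma connected_by_conn: "connected_by en V F \<longleftrightarrow> V \<times> V \<subseteq> conn en F"
  by (auto simp: connected_by_def conn_def)

lemma conn_refl [simp]: "(x, x) \<in> conn en F"
  by (simp add: conn_def)

lemma conn_edge: "e \<in> F \<Longrightarrow> en e = {x, y} \<Longrightarrow> (x, y) \<in> conn en F"
  unfolding conn_def by (rule r_into_rtrancl) auto

lemma conn_trans: "(x, y) \<in> conn en F \<Longrightarrow> (y, z) \<in> conn en F \<Longrightarrow> (x, z) \<in> conn en F"
  unfolding conn_def by (rule rtrancl_trans)

lemma conn_sym: "(x, y) \<in> conn en F \<Longrightarrow> (y, x) \<in> conn en F"
proof -
  have "sym {(x, y). \<exists>e\<in>F. en e = {x, y}}"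
    by (auto simp: sym_def insert_commute)
  then show "(x, y) \<in> conn en F \<Longrightarrow> (y, x) \<in> conn en F"
    unfolding conn_def by (meson sym_rtrancl symD)
qed

lemma conn_mono: "F \<subseteq> F' \<Longrightarrow> conn en F \<subseteq> conn en F'"
  unfolding conn_def by (rule rtrancl_mono) auto

lemma conn_subsetI:
  assumes "\<And>e x y. e \<in> F \<Longrightarrow> en e = {x, y} \<Longrightarrow> (x, y) \<in> conn en F'"
  shows "conn en F \<subseteq> conn en F'"
proof -
  have "{(x, y). \<exists>e\<in>F. en e = {x, y}} \<subseteq> conn en F'"
    using assms by auto
  then show ?thesis
    unfolding conn_def by (rule rtrancl_subset_rtrancl)
qed

text \<open>Inclusion is assumed for the relations, not for the edge sets: each edge of
  \<open>F\<close> may be replaced by a walk in \<open>F'\<close>. This is what compares a choice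
  with a maximal forest that does not contain it.\<close>

lemma conn_Un_mono:
  assumes "conn en F \<subseteq> conn en F'"
  shows "conn en (F \<union> G) \<subseteq> conn en (F' \<union> G)"
proof (rule conn_subsetI)
  fix e x y
  assume e: "e \<in> F \<union> G" "en e = {x, y}"
  have "conn en F \<subseteq> conn en (F' \<union> G)"
    using assms conn_mono[of F' "F' \<union> G" en] by auto
  then show "(x, y) \<in> conn en (F' \<union> G)"
    using e conn_edge[of e F en x y] conn_edge[of e "F' \<union> G" en x y] by auto
qed

lemma conn_insert_eq:
  assumes "en e = {u, v}" "(u, v) \<in> conn en F"
  shows "conn en (insert e F) = conn en F"
proof
  show "conn en (insert e F) \<subseteq> conn en F"
    by (rule conn_subsetI) (use assms conn_sym[OF assms(2)] in \<open>auto simp: doubleton_eq_iff intro: conn_edge\<close>)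
qed (simp add: conn_mono subset_insertI)

text \<open>A walk that uses \<open>e\<close> repeatedly can be shortened to use it at most once, in
  one of two directions. In terms of labels: the new edge merges the classes of its ends and changes
  nothing else.\<close>

lemma conn_insert_iff:
  assumes "en e = {u, v}"
  shows "(x, y) \<in> conn en (insert e F) \<longleftrightarrow> (x, y) \<in> conn en F \<or>
    (x, u) \<in> conn en F \<and> (v, y) \<in> conn en F \<or> (x, v) \<in> conn en F \<and> (u, y) \<in> conn en F"
    (is "?L \<longleftrightarrow> ?R y")
proof
  assume ?L
  then show "?R y"
    unfolding conn_def[of en "insert e F"]
  proof (induction rule: rtrancl_induct)
    case (step y z)
    then obtain f where f: "f \<in> insert e F" "en f = {y, z}"
      by auto
    show ?case
    proof (cases "f = e")
      case True
      then have "y = u \<and> z = v \<or> y = v \<and> z = u"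
        using assms f by (auto simp: doubleton_eq_iff)
      then show ?thesis
        using step.IH conn_refl conn_trans by metis
    next
      case False
      then have "(y, z) \<in> conn en F"
        using f by (auto intro: conn_edge)
      then show ?thesis
        using step.IH conn_trans[of _ y en F z] by blast
    qed
  qed simp
next
  have *: "p \<in> conn en (insert e F)" if "p \<in> conn en F" for p
    using that conn_mono[of F "insert e F" en] by auto
  have "(u, v) \<in> conn en (insert e F)"
    using assms by (intro conn_edge) auto
  moreover assume "?R y"
  ultimately show ?L
    using * conn_sym[of u v en "insert e F"] conn_trans[of x _ en "insert e F" _] by blast
qed

section \<open>Cycles and connectivity\<close>

lemma conn_simple_path:
  assumes "(u, v) \<in> conn en F"
  obtains vs es where "distinct vs" "vs \<noteq> []" "hd vs = u" "last vs = v"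
    "length vs = Suc (length es)" "set es \<subseteq> F"
    "\<And>i. i < length es \<Longrightarrow> en (es ! i) = {vs ! i, vs ! Suc i}"
proof -
  have "\<exists>vs es. distinct vs \<and> vs \<noteq> [] \<and> hd vs = u \<and> last vs = v \<and> length vs = Suc (length es) \<and>
      set es \<subseteq> F \<and> (\<forall>i < length es. en (es ! i) = {vs ! i, vs ! Suc i})"
    using assms unfolding conn_def
  proof (induction rule: rtrancl_induct)
    case base
    show ?case
      by (intro exI[of _ "[u]"] exI[of _ "[]"]) auto
  next
    case (step y z)
    then obtain vs es e where p: "distinct vs" "vs \<noteq> []" "hd vs = u" "last vs = y"
      "length vs = Suc (length es)" "set es \<subseteq> F"
      "\<forall>i < length es. en (es ! i) = {vs ! i, vs ! Suc i}" and e: "e \<in> F" "en e = {y, z}"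
      by auto
    \<comment> \<open>If the new end \<open>z\<close> already lies on the path, the path is cut off
      at \<open>z\<close>; otherwise it is prolonged. Simplicity is needed because
      \<open>is_cycle\<close> demands distinct vertices.\<close>
    show ?case
    proof (cases "z \<in> set vs")
      case True
      then obtain k where k: "k < length vs" "vs ! k = z"
        by (auto simp: in_set_conv_nth)
      have "last (take (Suc k) vs) = z"
        using k p by (simp add: take_Suc_conv_app_nth)
      moreover have "set (take k es) \<subseteq> F"
        using p set_take_subset by fastforce
      ultimately show ?thesis
        using p k by (intro exI[of _ "take (Suc k) vs"] exI[of _ "take k es"]) auto
    next
      case False
      have "en ((es @ [e]) ! i) = {(vs @ [z]) ! i, (vs @ [z]) ! Suc i}" if "i < Suc (length es)" for i
      proof (cases "i = length es")
        case True
        then show ?thesis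
          using p e by (auto simp: nth_append last_conv_nth)
      next
        case False
        then show ?thesis
          using p that by (auto simp: nth_append)
      qed
      then show ?thesis
        using p e False by (intro exI[of _ "vs @ [z]"] exI[of _ "es @ [e]"]) auto
    qed
  qed
  then show thesis
    using that by blast
qed

lemma cycle_if_conn:
  assumes e: "en e = {u, v}" "e \<notin> F" and "(u, v) \<in> conn en F"
  shows "\<exists>vs es. set es \<subseteq> insert e F \<and> is_cycle en vs es"
proof -
  obtain vs es where p: "distinct vs" "vs \<noteq> []" "hd vs = u" "last vs = v"
    "length vs = Suc (length es)" "set es \<subseteq> F"
    "\<And>i. i < length es \<Longrightarrow> en (es ! i) = {vs ! i, vs ! Suc i}"
    using assms(3) by (rule conn_simple_path) blast
  \<comment> \<open>Equal edges have equal ends, and on a list of distinct vertices a pair of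
    neighbours determines its position.\<close>
  have "distinct es"
    unfolding distinct_conv_nth
  proof (intro allI impI notI)
    fix i j
    assume ij: "i < length es" "j < length es" "i \<noteq> j" "es ! i = es ! j"
    then have "{vs ! i, vs ! Suc i} = {vs ! j, vs ! Suc j}"
      using p(7) by metis
    then show False
      using ij p(1,5) by (auto simp: doubleton_eq_iff nth_eq_iff_index_eq)
  qed
  moreover have "en ((es @ [e]) ! i) = {vs ! i, vs ! (Suc i mod Suc (length es))}"
    if "i < Suc (length es)" for i
  proof (cases "i = length es")
    case True
    then show ?thesis
      using p e by (auto simp: last_conv_nth hd_conv_nth)
  next
    case False
    then show ?thesis
      using p that by (auto simp: nth_append)
  qed
  ultimately have "is_cycle en vs (es @ [e])"
    using p e by (auto simp: is_cycle_def)
  moreover have "set (es @ [e]) \<subseteq> insert e F"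
    using p by auto
  ultimately show ?thesis by blast
qed

text \<open>The cycle must pass through \<open>e\<close>, as \<open>F\<close> has none; what remains
  of it leads from one end of \<open>e\<close> to the other inside \<open>F\<close>.\<close>

lemma conn_if_cycle:
  assumes e: "en e = {u, v}" and F: "cycle_free en F" and c: "\<not> cycle_free en (insert e F)"
  shows "(u, v) \<in> conn en F"
proof -
  obtain vs es where es: "set es \<subseteq> insert e F" and cyc: "is_cycle en vs es"
    using c by (auto simp: cycle_free_def)
  have "e \<in> set es"
    using es cyc F by (auto simp: cycle_free_def)
  then obtain j where j: "j < length es" "es ! j = e"
    by (auto simp: in_set_conv_nth)
  define n where "n = length es"
  have n: "j < n" "distinct es" and ends: "\<And>i. i < n \<Longrightarrow> en (es ! i) = {vs ! i, vs ! (Suc i mod n)}"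
    using j cyc by (auto simp: is_cycle_def n_def)
  have "(vs ! (Suc j mod n), vs ! ((Suc j + i) mod n)) \<in> conn en F" if "i < n" for i
    using that
  proof (induction i)
    case (Suc i)
    let ?q = "(Suc j + i) mod n"
    have "?q < n"
      using Suc by simp
    have "?q \<noteq> j"
    proof (cases "Suc j + i < n")
      case False
      then have "?q = Suc j + i - n"
        using Suc.prems n by (simp add: le_mod_geq)
      then show ?thesis
        using Suc.prems False by linarith
    qed simp
    then have "es ! ?q \<noteq> e"
      using j n \<open>?q < n\<close> by (auto simp: n_def nth_eq_iff_index_eq)
    then have "es ! ?q \<in> F"
      using es \<open>?q < n\<close> nth_mem[of ?q es] unfolding n_def by blast
    moreover have "Suc ?q mod n = (Suc j + Suc i) mod n"
      by (simp add: mod_Suc_eq)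
    ultimately have "(vs ! ?q, vs ! ((Suc j + Suc i) mod n)) \<in> conn en F"
      using ends[OF \<open>?q < n\<close>] by (metis conn_edge)
    then show ?case
      using Suc conn_trans by (metis Suc_lessD)
  qed simp
  from this[of "n - 1"] have "(vs ! (Suc j mod n), vs ! j) \<in> conn en F"
    using n by simp
  moreover have "{u, v} = {vs ! j, vs ! (Suc j mod n)}"
    using ends[OF n(1)] j e by simp
  ultimately show ?thesis
    by (auto simp: doubleton_eq_iff dest: conn_sym)
qed

text \<open>Turns the cycle test of the greedy rule into a question about components. The condition
  \<open>e \<notin> F\<close> matters: inserting an edge of \<open>F\<close> again closes no cycle
  although its ends are connected.\<close>

lemma cycle_free_insert:
  assumes "cycle_free en F" "e \<notin> F" "en e = {u, v}"
  shows "cycle_free en (insert e F) \<longleftrightarrow> (u, v) \<notin> conn en F"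
  using cycle_if_conn[of en e u v F] conn_if_cycle[of en e u v F] assms
  by (auto simp: cycle_free_def)

lemma cycle_free_empty [simp]: "cycle_free en {}"
  by (auto simp: cycle_free_def is_cycle_def)

lemma card_2_ends: "card A = 2 \<Longrightarrow> \<exists>u v. A = {u, v}"
  by (auto simp: card_2_iff)

section \<open>Span of the greedy completion and its dependence on the starting forest\<close>

lemma greedy_append: "greedy en X (es @ es') Y = greedy en X es' (greedy en X es Y)"
  by (induction es arbitrary: Y) auto

lemma greedy_subset: "greedy en X es Y \<subseteq> Y \<union> set es"
proof (induction es arbitrary: Y)
  case (Cons e es)
  show ?case
    using Cons[of "insert e Y"] Cons[of Y] by auto
qed simp

lemma greedy_cycle_free: "cycle_free en (X \<union> Y) \<Longrightarrow> cycle_free en (X \<union> greedy en X es Y)"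
  by (induction es arbitrary: Y) auto

text \<open>A rejected edge has ends that are already connected, so leaving it out loses no
  connection.\<close>

lemma greedy_conn:
  assumes "cycle_free en (X \<union> Y)" "distinct es" "set es \<inter> (X \<union> Y) = {}"
    "\<forall>e\<in>set es. card (en e) = 2"
  shows "conn en (X \<union> greedy en X es Y) = conn en (X \<union> Y \<union> set es)"
  using assms
proof (induction es arbitrary: Y)
  case (Cons e es)
  obtain u v where uv: "en e = {u, v}"
    using Cons.prems card_2_ends by force
  have ins: "X \<union> Y \<union> {e} = insert e (X \<union> Y)" "X \<union> insert e Y = insert e (X \<union> Y)"
    by auto
  show ?case
  proof (cases "cycle_free en (insert e (X \<union> Y))")
    case True
    have "conn en (X \<union> greedy en X es (insert e Y)) = conn en (X \<union> insert e Y \<union> set es)"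
      using Cons.prems True ins by (intro Cons.IH) auto
    then show ?thesis
      using True ins by simp
  next
    case False
    then have "(u, v) \<in> conn en (X \<union> Y)"
      using cycle_free_insert[OF Cons.prems(1) _ uv] Cons.prems by auto
    then have "conn en (insert e (X \<union> Y)) = conn en (X \<union> Y)"
      by (rule conn_insert_eq[of en e u v, OF uv])
    then have "conn en (insert e (X \<union> Y) \<union> set es) = conn en (X \<union> Y \<union> set es)"
      by (intro subset_antisym conn_Un_mono) auto
    moreover have "conn en (X \<union> greedy en X es Y) = conn en (X \<union> Y \<union> set es)"
      using Cons.prems by (intro Cons.IH) auto
    ultimately show ?thesis
      using False ins by simp
  qed
qed simp

text \<open>Both runs read the same list, and the last two assumptions are the invariant. Whatever
  the better connected primed run accepts, the other run accepts too, so
  \<open>Y' \<subseteq> Y\<close> persists.\<close>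

lemma greedy_antimono:
  assumes "cycle_free en (X \<union> Y)" "cycle_free en (X' \<union> Y')" "distinct es"
    "set es \<inter> (X \<union> Y) = {}" "set es \<inter> (X' \<union> Y') = {}" "\<forall>e\<in>set es. card (en e) = 2"
    "conn en (X \<union> Y) \<subseteq> conn en (X' \<union> Y')" "Y' \<subseteq> Y"
  shows "greedy en X' es Y' \<subseteq> greedy en X es Y"
  using assms
proof (induction es arbitrary: Y Y')
  case (Cons e es)
  obtain u v where uv: "en e = {u, v}"
    using Cons.prems card_2_ends by force
  have ins: "X \<union> Y \<union> {e} = insert e (X \<union> Y)" "X' \<union> Y' \<union> {e} = insert e (X' \<union> Y')"
    "X \<union> insert e Y = insert e (X \<union> Y)" "X' \<union> insert e Y' = insert e (X' \<union> Y')"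
    by auto
  have cf: "cycle_free en (insert e (X \<union> Y)) \<longleftrightarrow> (u, v) \<notin> conn en (X \<union> Y)"
    using Cons.prems by (intro cycle_free_insert uv) auto
  have cf': "cycle_free en (insert e (X' \<union> Y')) \<longleftrightarrow> (u, v) \<notin> conn en (X' \<union> Y')"
    using Cons.prems by (intro cycle_free_insert uv) auto
  have mono: "conn en (insert e (X \<union> Y)) \<subseteq> conn en (insert e (X' \<union> Y'))"
    using conn_Un_mono[OF Cons.prems(7), of "{e}"] by simp
  have eq': "conn en (insert e (X' \<union> Y')) = conn en (X' \<union> Y')" if "(u, v) \<in> conn en (X' \<union> Y')"
    using conn_insert_eq[of en e u v, OF uv that] .
  consider "(u, v) \<notin> conn en (X' \<union> Y')" | "(u, v) \<in> conn en (X' \<union> Y')" "(u, v) \<notin> conn en (X \<union> Y)"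
    | "(u, v) \<in> conn en (X \<union> Y)"
    by blast
  then show ?case
  proof cases
    case 1
    then have "(u, v) \<notin> conn en (X \<union> Y)"
      using Cons.prems(7) by auto
    moreover have "greedy en X' es (insert e Y') \<subseteq> greedy en X es (insert e Y)"
      using Cons.prems cf cf' 1 calculation mono by (intro Cons.IH) (auto simp: ins)
    ultimately show ?thesis
      using 1 cf cf' ins by simp
  next
    \<comment> \<open>Only the unprimed run accepts \<open>e\<close>. Its connectivity grows, but
      not beyond that of \<open>X' \<union> Y'\<close>, where the ends of \<open>e\<close> are
      joined already.\<close>
    case 2
    have "greedy en X' es Y' \<subseteq> greedy en X es (insert e Y)"
      using Cons.prems cf cf' 2 mono eq' by (intro Cons.IH) (auto simp: ins)
    then show ?thesis
      using 2 cf cf' ins by simp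
  next
    case 3
    then have "(u, v) \<in> conn en (X' \<union> Y')"
      using Cons.prems(7) by auto
    moreover have "greedy en X' es Y' \<subseteq> greedy en X es Y"
      using Cons.prems by (intro Cons.IH) auto
    ultimately show ?thesis
      using 3 cf cf' ins by simp
  qed
qed simp


section \<open>Optimal choices as maximal forests below a threshold\<close>

text \<open>\<open>t\<close> merely carries a cost value and may be a follower's edge.\<close>

definition cheap :: "('v, nat) bmst \<Rightarrow> nat \<Rightarrow> nat \<Rightarrow> bool" where
  "cheap I t e \<longleftrightarrow> e \<in> leader_edges I \<and> leader_cost I e \<le> leader_cost I t"

text \<open>Kruskal's rule without weights: any order yields a maximal forest. Expressing it by
  \<open>greedy\<close> makes the lemmas on the follower's rule apply to the leader's forest as
  well; \<open>j\<close> will be the counter of the program's loop.\<close>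

definition cheap_forest :: "('v, nat) bmst \<Rightarrow> nat \<Rightarrow> nat \<Rightarrow> nat set" where
  "cheap_forest I t j = greedy (ends I) {} (filter (cheap I t) [0..<j]) {}"

abbreviation threshold_choice :: "('v, nat) bmst \<Rightarrow> nat \<Rightarrow> nat set" where
  "threshold_choice I t \<equiv> cheap_forest I t (card (edges I))"

text \<open>The edges of the forest cost at most \<open>leader_cost I t\<close> by construction, so
  only the response has to be tested.\<close>

definition achievable :: "('v, nat) bmst \<Rightarrow> nat \<Rightarrow> bool" where
  "achievable I t \<longleftrightarrow>
     (\<forall>e\<in>response I (threshold_choice I t). leader_cost I e \<le> leader_cost I t) \<and>
     connected_by (ends I) (verts I) (threshold_choice I t \<union> follower_edges I)"

lemma cheap_forest_subset: "cheap_forest I t j \<subseteq> {e. e < j \<and> cheap I t e}"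
  using greedy_subset[of "ends I" "{}" "filter (cheap I t) [0..<j]" "{}"]
  by (auto simp: cheap_forest_def)

lemma cheap_forest_cycle_free: "cycle_free (ends I) (cheap_forest I t j)"
  using greedy_cycle_free[of "ends I" "{}" "{}"] by (simp add: cheap_forest_def)

section \<open>The best achievable threshold gives an optimal choice\<close>

locale instance_on_numbers =
  fixes I :: "(nat, nat) bmst"
  assumes input: "I \<in> bmst_inputs"
begin

abbreviation "n \<equiv> card (verts I)"
abbreviation "k \<equiv> card (edges I)"
abbreviation "m \<equiv> length (follower_order I)"

lemma inst: "bmst_instance I" and verts: "verts I = {0..<n}" and edges: "edges I = {0..<k}"
  using input unfolding bmst_inputs_def by blast+

lemma edge_less: "e \<in> edges I \<longleftrightarrow> e < k"
  by (metis atLeastLessThan_iff edges zero_le)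

lemma vert_less: "u \<in> verts I \<longleftrightarrow> u < n"
  by (metis atLeastLessThan_iff verts zero_le)

lemma n_pos: "0 < n"
  using inst by (auto simp: bmst_instance_def card_gt_0_iff)

lemma ends_card: "e < k \<Longrightarrow> card (ends I e) = 2" and ends_verts: "e < k \<Longrightarrow> ends I e \<subseteq> verts I"
  using inst edge_less by (auto simp: bmst_instance_def)

lemma ends_Min_Max:
  assumes "e < k"
  shows "ends I e = {Min (ends I e), Max (ends I e)}" "Min (ends I e) < n" "Max (ends I e) < n"
proof -
  obtain u v where uv: "ends I e = {u, v}" "u \<noteq> v"
    using ends_card[OF assms] by (auto simp: card_2_iff)
  show eq: "ends I e = {Min (ends I e), Max (ends I e)}"
    unfolding uv by (auto simp: min_def max_def)
  show "Min (ends I e) < n" "Max (ends I e) < n"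
    using ends_verts[OF assms] eq vert_less by auto
qed

lemma order: "distinct (follower_order I)" "set (follower_order I) = follower_edges I"
  using inst by (auto simp: bmst_instance_def)

lemma disjoint: "leader_edges I \<inter> follower_edges I = {}"
  using inst by (auto simp: bmst_instance_def)

lemma order_edges: "set (follower_order I) \<subseteq> {0..<k}"
proof
  fix e
  assume "e \<in> set (follower_order I)"
  then have "e \<in> edges I"
    using order(2) by (simp add: edges_def)
  then show "e \<in> {0..<k}"
    by (simp add: edge_less)
qed

lemma order_less: "j < m \<Longrightarrow> follower_order I ! j < k"
  using order_edges nth_mem[of j "follower_order I"] by fastforce

lemma m_le_k: "m \<le> k"
proof -
  have "card (set (follower_order I)) \<le> card {0..<k}"
    using order_edges by (intro card_mono) auto
  then show ?thesis
    using distinct_card[OF order(1)] by simp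
qed

lemma order_ends: "\<forall>e\<in>set (follower_order I). card (ends I e) = 2"
  using order_edges ends_card by auto

text \<open>Lets feasibility of a choice be read off from the final tree, whose components the
  program knows after the follower's run.\<close>

lemma response_conn:
  assumes "cycle_free (ends I) X" "X \<subseteq> leader_edges I"
  shows "conn (ends I) (X \<union> response I X) = conn (ends I) (X \<union> follower_edges I)"
  using greedy_conn[of "ends I" X "{}" "follower_order I"] assms order disjoint order_ends
  unfolding response_def by auto

lemma response_subset: "response I X \<subseteq> follower_edges I"
  using greedy_subset[of "ends I" X "follower_order I" "{}"] order by (simp add: response_def)

lemma cheap_forest_conn:
  assumes "j \<le> k"
  shows "conn (ends I) (cheap_forest I t j) = conn (ends I) {e. e < j \<and> cheap I t e}"
  using greedy_conn[of "ends I" "{}" "{}" "filter (cheap I t) [0..<j]"] assms ends_card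
  by (auto simp: cheap_forest_def)

lemma cheap_forest_leader: "cheap_forest I t j \<subseteq> leader_edges I"
  using cheap_forest_subset[of I t j] by (auto simp: cheap_def)

lemma cost_nonneg: "t < k \<Longrightarrow> 0 \<le> leader_cost I t"
  using inst edge_less by (auto simp: bmst_instance_def)

lemma feasible_threshold_choice:
  "achievable I t \<Longrightarrow> feasible_choice I (threshold_choice I t)"
  by (simp add: feasible_choice_def achievable_def cheap_forest_leader cheap_forest_cycle_free)

lemma finite_tree: "X \<subseteq> leader_edges I \<Longrightarrow> finite (X \<union> response I X)"
  using response_subset inst by (auto simp: bmst_instance_def edges_def intro: finite_subset)

text \<open>The inequality may be strict, as \<open>t\<close> need not belong to the tree.
  Nonnegative costs cover the empty tree, whose bottleneck is 0.\<close>

lemma bottleneck_threshold_choice: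
  assumes "t < k" "achievable I t"
  shows "bottleneck I (threshold_choice I t) \<le> leader_cost I t"
proof -
  have "finite (threshold_choice I t \<union> response I (threshold_choice I t))"
    by (intro finite_tree cheap_forest_leader)
  then show ?thesis
    using assms cost_nonneg[of t] cheap_forest_subset[of I t k]
    by (auto simp: bottleneck_def Let_def achievable_def cheap_def)
qed

text \<open>Take \<open>t\<close> as a most expensive edge of the tree. All of \<open>X\<close> is
  then cheap, so the threshold forest connects at least as much as \<open>X\<close>; its response is
  contained in that of \<open>X\<close>, hence costs at most \<open>leader_cost I t\<close> per
  edge, and feasibility carries over.\<close>

lemma achievable_bottleneck:
  assumes "feasible_choice I X" "0 < k"
  obtains t where "t < k" "achievable I t" "leader_cost I t = bottleneck I X"
proof -
  have X: "X \<subseteq> leader_edges I" "cycle_free (ends I) X"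
    "connected_by (ends I) (verts I) (X \<union> follower_edges I)"
    using assms by (auto simp: feasible_choice_def)
  let ?T = "X \<union> response I X"
  have fin: "finite ?T"
    by (rule finite_tree) fact
  have sub: "?T \<subseteq> edges I"
    using X response_subset by (auto simp: edges_def)
  \<comment> \<open>Edge 0 exists and has two distinct ends, which an empty tree cannot
    connect.\<close>
  have "?T \<noteq> {}"
  proof
    assume "?T = {}"
    then have "verts I \<times> verts I \<subseteq> conn (ends I) {}"
      using X(3) response_conn[OF X(2,1)] unfolding connected_by_conn by metis
    then have "verts I \<times> verts I \<subseteq> Id"
      by (simp add: conn_def)
    moreover have "0 < k"
      by fact
    then have "card (ends I 0) = 2" "ends I 0 \<subseteq> verts I"
      by (auto simp only: ends_card ends_verts)
    ultimately show False
      by (auto simp: card_2_iff)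
  qed
  then have bot: "bottleneck I X = Max (leader_cost I ` ?T)"
    unfolding bottleneck_def Let_def by (simp only: if_False)
  also have "\<dots> \<in> leader_cost I ` ?T"
    using fin \<open>?T \<noteq> {}\<close> by (intro Max_in) auto
  finally obtain t where t: "t \<in> ?T" "leader_cost I t = bottleneck I X"
    by (metis imageE)
  have le: "leader_cost I e \<le> leader_cost I t" if "e \<in> ?T" for e
    using that fin t bot by auto
  let ?Z = "threshold_choice I t"
  have "X \<subseteq> {e. e < k \<and> cheap I t e}"
    using X sub le edge_less by (auto simp: cheap_def)
  then have span: "conn (ends I) X \<subseteq> conn (ends I) ?Z"
    using cheap_forest_conn[of k t] conn_mono by fastforce
  have "response I ?Z \<subseteq> response I X"
    unfolding response_def
    using X span order disjoint order_ends cheap_forest_leader cheap_forest_cycle_free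
    by (intro greedy_antimono) fastforce+
  moreover have "connected_by (ends I) (verts I) (?Z \<union> follower_edges I)"
    using conn_Un_mono[OF span] X(3) unfolding connected_by_conn by blast
  ultimately have "achievable I t"
    using le by (auto simp: achievable_def)
  then show thesis
    using that t sub edge_less by blast
qed

text \<open>With a most expensive edge as threshold every leader's edge is cheap, so the forest
  spans what all leader's edges span, and the whole graph is connected.\<close>

lemma feasible_exists: "\<exists>X. feasible_choice I X"
proof (cases "k = 0")
  case True
  then have "edges I = {}"
    using edge_less by auto
  then have "follower_edges I = edges I"
    by (simp add: edges_def)
  then have "feasible_choice I {}"
    using inst by (simp add: feasible_choice_def bmst_instance_def)
  then show ?thesis ..
next
  case False
  then have "finite (edges I)" "edges I \<noteq> {}"
    by (auto intro: ccontr)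
  then obtain t where t: "t \<in> edges I" "leader_cost I t = Max (leader_cost I ` edges I)"
    using Max_in[of "leader_cost I ` edges I"] by (metis finite_imageI image_is_empty imageE)
  then have max: "leader_cost I e \<le> leader_cost I t" if "e \<in> edges I" for e
    using that t \<open>finite (edges I)\<close> by simp
  have "leader_edges I \<subseteq> edges I"
    by (simp add: edges_def)
  then have "{e. e < k \<and> cheap I t e} = leader_edges I"
    using max unfolding cheap_def edge_less[symmetric] by blast
  then have "conn (ends I) (leader_edges I) \<subseteq> conn (ends I) (threshold_choice I t)"
    using cheap_forest_conn[of k t] by simp
  then have "conn (ends I) (leader_edges I \<union> follower_edges I)
      \<subseteq> conn (ends I) (threshold_choice I t \<union> follower_edges I)"
    by (rule conn_Un_mono)
  then have "connected_by (ends I) (verts I) (threshold_choice I t \<union> follower_edges I)"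
    using inst unfolding bmst_instance_def connected_by_conn edges_def by blast
  then have "feasible_choice I (threshold_choice I t)"
    by (simp add: feasible_choice_def cheap_forest_leader cheap_forest_cycle_free)
  then show ?thesis ..
qed

lemma achievable_exists: "0 < k \<Longrightarrow> \<exists>t<k. achievable I t"
  using feasible_exists achievable_bottleneck by metis

lemma optimal_threshold_choice:
  assumes "t < k" "achievable I t"
    "\<And>t'. t' < k \<Longrightarrow> achievable I t' \<Longrightarrow> leader_cost I t \<le> leader_cost I t'"
  shows "optimal_choice I (threshold_choice I t)"
  unfolding optimal_choice_def
proof (intro conjI allI impI)
  show "feasible_choice I (threshold_choice I t)"
    by (rule feasible_threshold_choice) fact
  fix X
  assume "feasible_choice I X"
  then obtain t' where t': "t' < k" "achievable I t'" "leader_cost I t' = bottleneck I X"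
    using achievable_bottleneck assms(1) by (metis gr_implies_not0 not_gr_zero)
  have "bottleneck I (threshold_choice I t) \<le> leader_cost I t"
    by (rule bottleneck_threshold_choice) fact+
  also have "\<dots> \<le> bottleneck I X"
    using assms(3)[OF t'(1,2)] t'(3) by simp
  finally show "bottleneck I (threshold_choice I t) \<le> bottleneck I X" .
qed

text \<open>No edge can act as a threshold here, but \<open>{}\<close> is the only candidate and
  some feasible choice exists.\<close>

lemma optimal_empty: "k = 0 \<Longrightarrow> optimal_choice I {}"
proof -
  assume "k = 0"
  then have "edges I = {}"
    using edge_less by auto
  then have "leader_edges I = {}"
    by (simp add: edges_def)
  then show "optimal_choice I {}"
    using feasible_exists by (auto simp: optimal_choice_def feasible_choice_def)
qed

end

section \<open>A program logic for total correctness with time bounds\<close>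

text \<open>\<open>T\<close> is an upper bound rather than the exact time, so that branches of
  different length share one bound.\<close>

definition halts :: "com \<Rightarrow> state \<Rightarrow> nat \<Rightarrow> (state \<Rightarrow> bool) \<Rightarrow> bool" where
  "halts p s T Q \<longleftrightarrow> (\<exists>t r. runs p s t r \<and> t \<le> T \<and> Q r)"

lemma halts_mono:
  "halts p s T Q \<Longrightarrow> T \<le> T' \<Longrightarrow> (\<And>r. Q r \<Longrightarrow> Q' r) \<Longrightarrow> halts p s T' Q'"
  unfolding halts_def using le_trans by blast

lemma halts_Skip: "Q s \<Longrightarrow> 1 \<le> T \<Longrightarrow> halts Skip s T Q"
  unfolding halts_def using runs.Skip by blast

lemma halts_Assign:
  "Q (s\<lparr>nvar := (nvar s)(x := nval s i)\<rparr>) \<Longrightarrow> 1 \<le> T \<Longrightarrow> halts (Assign x i) s T Q"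
  unfolding halts_def using runs.Assign by blast

lemma halts_Put:
  "Q (s\<lparr>narr := put (narr s) a (nval s i) (nval s j)\<rparr>) \<Longrightarrow> 1 \<le> T \<Longrightarrow> halts (Put a i j) s T Q"
  unfolding halts_def using runs.Put by blast

lemma halts_Seq:
  assumes "halts p s T R" "\<And>r. R r \<Longrightarrow> halts q r T' Q"
  shows "halts (Seq p q) s (T + T') Q"
proof -
  obtain t r where "runs p s t r" "t \<le> T" "R r"
    using assms(1) by (auto simp: halts_def)
  moreover obtain t' r' where "runs q r t' r'" "t' \<le> T'" "Q r'"
    using assms(2)[OF \<open>R r\<close>] by (auto simp: halts_def)
  ultimately have "runs (Seq p q) s (t + t') r' \<and> t + t' \<le> T + T' \<and> Q r'"
    by (simp add: runs.Seq add_mono)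
  then show ?thesis
    unfolding halts_def by blast
qed

lemma halts_Assign_Seq:
  "halts q (s\<lparr>nvar := (nvar s)(x := nval s i)\<rparr>) T Q \<Longrightarrow> halts (Seq (Assign x i) q) s (Suc T) Q"
  using halts_Seq[of "Assign x i" s 1 "\<lambda>r. r = s\<lparr>nvar := (nvar s)(x := nval s i)\<rparr>" q T Q]
    halts_Assign by auto

lemma halts_Put_Seq:
  "halts q (s\<lparr>narr := put (narr s) a (nval s i) (nval s j)\<rparr>) T Q \<Longrightarrow>
    halts (Seq (Put a i j) q) s (Suc T) Q"
  using halts_Seq[of "Put a i j" s 1
      "\<lambda>r. r = s\<lparr>narr := put (narr s) a (nval s i) (nval s j)\<rparr>" q T Q] halts_Put by auto

lemma halts_Cond:
  assumes "bval s b \<Longrightarrow> halts p s T Q" "\<not> bval s b \<Longrightarrow> halts q s T Q"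
  shows "halts (Cond b p q) s (Suc T) Q"
proof (cases "bval s b")
  case True
  then obtain t r where "runs p s t r" "t \<le> T" "Q r"
    using assms(1) by (auto simp: halts_def)
  then show ?thesis
    unfolding halts_def using runs.CondTrue[OF True] Suc_le_mono by blast
next
  case False
  then obtain t r where "runs q s t r" "t \<le> T" "Q r"
    using assms(2) by (auto simp: halts_def)
  then show ?thesis
    unfolding halts_def using runs.CondFalse[OF False] Suc_le_mono by blast
qed

definition Equal :: "nexp \<Rightarrow> nexp \<Rightarrow> bexp" where
  "Equal i j = Conj (Leq i j) (Leq j i)"

lemma bval_Equal [simp]: "bval s (Equal i j) \<longleftrightarrow> nval s i = nval s j"
  by (auto simp: Equal_def)

definition For :: "vname \<Rightarrow> vname \<Rightarrow> com \<Rightarrow> com" where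
  "For x y p = Seq (Assign x (Num 0))
     (While (Neg (Leq (Var y) (Var x))) (Seq p (Assign x (Add (Var x) (Num 1)))))"

text \<open>\<open>J j\<close> describes the state in which the counter has just become
  \<open>j\<close>, hence the update in the conclusion of \<open>body\<close>. Each round adds 2 to
  the time of the body, for test and increment; the leading 2 pays for the initialisation and the
  failing last test.\<close>

lemma halts_For:
  assumes init: "J 0 (s\<lparr>nvar := (nvar s)(x := 0)\<rparr>)"
    and bound: "\<And>j r. J j r \<Longrightarrow> nvar r y = K"
    and body: "\<And>j r. j < K \<Longrightarrow> J j r \<Longrightarrow> nvar r x = j \<Longrightarrow>
      halts p r T (\<lambda>q. nvar q x = j \<and> J (Suc j) (q\<lparr>nvar := (nvar q)(x := Suc j)\<rparr>))"
  shows "halts (For x y p) s (2 + K * (T + 2)) (J K)"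
proof -
  let ?p = "Seq p (Assign x (Add (Var x) (Num 1)))"
  let ?w = "While (Neg (Leq (Var y) (Var x))) ?p"
  \<comment> \<open>\<open>i\<close> is the number of rounds still to come.\<close>
  have loop: "halts ?w r (1 + i * (T + 2)) (J K)" if "J j r" "nvar r x = j" "j + i = K" for i j r
    using that
  proof (induction i arbitrary: j r)
    case 0
    then have "\<not> bval r (Neg (Leq (Var y) (Var x)))"
      using bound[of j r] by simp
    then show ?case
      using 0 runs.WhileFalse unfolding halts_def
      by (intro exI[of _ 1] exI[of _ r]) auto
  next
    case (Suc i)
    then have b: "bval r (Neg (Leq (Var y) (Var x)))"
      using bound[of j r] by simp
    obtain t q where q: "runs p r t q" "t \<le> T" "nvar q x = j"
      "J (Suc j) (q\<lparr>nvar := (nvar q)(x := Suc j)\<rparr>)"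
      using body[of j r] Suc.prems by (auto simp: halts_def)
    let ?q = "q\<lparr>nvar := (nvar q)(x := Suc j)\<rparr>"
    have "runs (Assign x (Add (Var x) (Num 1))) q 1 ?q"
      using runs.Assign[of x "Add (Var x) (Num 1)" q] q(3) by simp
    then have "runs ?p r (t + 1) ?q"
      by (rule runs.Seq[OF q(1)])
    moreover obtain t' z where z: "runs ?w ?q t' z" "t' \<le> 1 + i * (T + 2)" "J K z"
      using Suc.IH[of "Suc j" ?q] Suc.prems q(4) by (auto simp: halts_def)
    ultimately have "runs ?w r (Suc (t + 1 + t')) z"
      using runs.WhileTrue[OF b] by blast
    moreover have "Suc (t + 1 + t') \<le> 1 + Suc i * (T + 2)"
      using q(2) z(2) by simp
    ultimately show ?case
      using z(3) unfolding halts_def by blast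
  qed
  have "halts (For x y p) s (Suc (1 + K * (T + 2))) (J K)"
    unfolding For_def by (rule halts_Assign_Seq) (use loop[of 0 _ K] init in simp)
  then show ?thesis by simp
qed

text \<open>A frame condition: \<open>xs\<close> and \<open>as\<close> list what may change. Real
  cells are input only.\<close>

definition agrees :: "vname set \<Rightarrow> vname set \<Rightarrow> state \<Rightarrow> state \<Rightarrow> bool" where
  "agrees xs as s r \<longleftrightarrow> (\<forall>x. x \<notin> xs \<longrightarrow> nvar r x = nvar s x) \<and>
     (\<forall>a. a \<notin> as \<longrightarrow> narr r a = narr s a) \<and> rarr r = rarr s"

lemma agrees_trans:
  "agrees xs as s r \<Longrightarrow> agrees xs' as' r q \<Longrightarrow> xs \<subseteq> ys \<Longrightarrow> xs' \<subseteq> ys \<Longrightarrow> as \<subseteq> bs \<Longrightarrow> as' \<subseteq> bs \<Longrightarrow>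
    agrees ys bs s q"
  unfolding agrees_def by (simp add: subset_iff) metis

lemma agrees_nvar: "agrees xs as s r \<Longrightarrow> x \<notin> xs \<Longrightarrow> nvar r x = nvar s x"
  by (simp add: agrees_def)


section \<open>The program\<close>

text \<open>Cell \<open>lab\<close> holds a labelling of the vertices by the components of the current forest. Edge \<open>e\<close>
  closes a cycle iff the labels \<open>a\<close> and \<open>b\<close> of its ends coincide, and then \<open>Join\<close> has no effect.\<close>

definition Join :: com where
  "Join =
     Seq (Assign ''a'' (Get ''lab'' (Get ''u'' (Var ''e''))))
    (Seq (Assign ''b'' (Get ''lab'' (Get ''v'' (Var ''e''))))
    (For ''i'' ''n''
      (Cond (Equal (Get ''lab'' (Var ''i'')) (Var ''a'')) (Put ''lab'' (Var ''i'') (Var ''b'')) Skip)))"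

definition Init :: com where
  "Init = For ''i'' ''n'' (Put ''lab'' (Var ''i'') (Var ''i''))"

text \<open>\<open>Y\<close> may still hold the forest of the previous threshold, so each entry is
  cleared when its edge is reached.\<close>

definition Lead :: com where
  "Lead = For ''e'' ''k''
    (Seq (Put ''Y'' (Var ''e'') (Num 0))
      (Cond (Conj (Leq (Num 1) (Get ''leader'' (Var ''e'')))
          (RLeq (RGet ''c'' (Var ''e'')) (RGet ''c'' (Var ''t''))))
        (Seq Join (Cond (Equal (Var ''a'') (Var ''b'')) Skip (Put ''Y'' (Var ''e'') (Num 1))))
        Skip))"

definition Follow :: com where
  "Follow = For ''j'' ''m''
    (Seq (Assign ''e'' (Get ''order'' (Var ''j'')))
    (Seq Join
      (Cond (Equal (Var ''a'') (Var ''b'')) Skip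
        (Cond (RLeq (RGet ''c'' (Var ''e'')) (RGet ''c'' (Var ''t''))) Skip
          (Assign ''ok'' (Num 0))))))"

text \<open>Vertex 0 serves as reference point; it exists since an instance has at least one
  vertex.\<close>

definition Check :: com where
  "Check = For ''i'' ''n''
    (Cond (Equal (Get ''lab'' (Var ''i'')) (Get ''lab'' (Num 0))) Skip (Assign ''ok'' (Num 0)))"

definition Test :: com where
  "Test = Seq Init (Seq Lead (Seq (Assign ''ok'' (Num 1)) (Seq Follow Check)))"

text \<open>A copy is needed because later thresholds overwrite \<open>Y\<close>.\<close>

definition Save :: com where
  "Save = For ''e'' ''k'' (Put ''X'' (Var ''e'') (Get ''Y'' (Var ''e'')))"

text \<open>\<open>found\<close> replaces an infinite initial value for the best cost: before the
  first success \<open>best\<close> means nothing.\<close>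

definition Solve :: com where
  "Solve = For ''t'' ''k''
    (Seq Test
      (Cond (Conj (Leq (Num 1) (Var ''ok''))
          (Neg (Conj (Leq (Num 1) (Var ''found''))
            (RLeq (RGet ''c'' (Var ''best'')) (RGet ''c'' (Var ''t''))))))
        (Seq (Assign ''found'' (Num 1)) (Seq (Assign ''best'' (Var ''t'')) Save))
        Skip))"

section \<open>Specifications of the loops that do not depend on the instance\<close>

definition relabel :: "nat \<Rightarrow> nat \<Rightarrow> nat \<Rightarrow> (nat \<Rightarrow> nat) \<Rightarrow> nat \<Rightarrow> nat" where
  "relabel n a b L = (\<lambda>i. if i < n \<and> L i = a then b else L i)"

lemma relabel_same [simp]: "relabel n a a L = L"
  by (auto simp: relabel_def)

lemma halts_Join:
  assumes "a = narr s ''lab'' (narr s ''u'' (nvar s ''e''))"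
    "b = narr s ''lab'' (narr s ''v'' (nvar s ''e''))"
  shows "halts Join s (4 + 4 * nvar s ''n'') (\<lambda>r. agrees {''a'', ''b'', ''i''} {''lab''} s r \<and>
    nvar r ''a'' = a \<and> nvar r ''b'' = b \<and>
    narr r ''lab'' = relabel (nvar s ''n'') a b (narr s ''lab''))"
proof -
  \<comment> \<open>The first argument of \<open>relabel\<close> doubles as loop counter: after
    \<open>j\<close> rounds exactly the labels below \<open>j\<close> are treated. Since
    \<open>a\<close> and \<open>b\<close> were read beforehand, overwriting labels is
    harmless.\<close>
  let ?J = "\<lambda>j r. agrees {''a'', ''b'', ''i''} {''lab''} s r \<and> nvar r ''a'' = a \<and>
    nvar r ''b'' = b \<and> narr r ''lab'' = relabel j a b (narr s ''lab'')"
  have "halts Join s (Suc (Suc (2 + nvar s ''n'' * (2 + 2)))) (?J (nvar s ''n''))"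
    unfolding Join_def
  proof (intro halts_Assign_Seq halts_For[where J = ?J])
    fix j r
    assume "j < nvar s ''n''" "?J j r" "nvar r ''i'' = j"
    then show "halts (Cond (Equal (Get ''lab'' (Var ''i'')) (Var ''a''))
        (Put ''lab'' (Var ''i'') (Var ''b'')) Skip) r 2
        (\<lambda>q. nvar q ''i'' = j \<and> ?J (Suc j) (q\<lparr>nvar := (nvar q)(''i'' := Suc j)\<rparr>))"
      unfolding numeral_2_eq_2
      by (intro halts_Cond halts_Put halts_Skip)
        (auto simp: agrees_def put_def relabel_def fun_eq_iff less_Suc_eq)
  qed (use assms in \<open>auto simp: agrees_def relabel_def\<close>)
  then show ?thesis
    by (rule halts_mono) auto
qed

lemma halts_Init:
  "halts Init s (2 + nvar s ''n'' * 3)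
    (\<lambda>r. agrees {''i''} {''lab''} s r \<and> (\<forall>x<nvar s ''n''. narr r ''lab'' x = x))"
proof -
  let ?J = "\<lambda>j r. agrees {''i''} {''lab''} s r \<and> (\<forall>x<j. narr r ''lab'' x = x)"
  have "halts Init s (2 + nvar s ''n'' * (1 + 2)) (?J (nvar s ''n''))"
    unfolding Init_def
    by (intro halts_For[where J = ?J] halts_Put) (auto simp: agrees_def put_def less_Suc_eq)
  then show ?thesis
    by (rule halts_mono) auto
qed

lemma halts_Check:
  "halts Check s (2 + nvar s ''n'' * 4)
    (\<lambda>r. agrees {''i'', ''ok''} {} s r \<and>
      (nvar r ''ok'' \<noteq> 0 \<longleftrightarrow>
        nvar s ''ok'' \<noteq> 0 \<and> (\<forall>x<nvar s ''n''. narr s ''lab'' x = narr s ''lab'' 0)))"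
proof -
  let ?J = "\<lambda>j r. agrees {''i'', ''ok''} {} s r \<and>
    (nvar r ''ok'' \<noteq> 0 \<longleftrightarrow> nvar s ''ok'' \<noteq> 0 \<and> (\<forall>x<j. narr s ''lab'' x = narr s ''lab'' 0))"
  have "halts Check s (2 + nvar s ''n'' * (2 + 2)) (?J (nvar s ''n''))"
    unfolding Check_def
  proof (intro halts_For[where J = ?J])
    fix j r
    assume "j < nvar s ''n''" "?J j r" "nvar r ''i'' = j"
    then show "halts (Cond (Equal (Get ''lab'' (Var ''i'')) (Get ''lab'' (Num 0))) Skip
        (Assign ''ok'' (Num 0))) r 2
        (\<lambda>q. nvar q ''i'' = j \<and> ?J (Suc j) (q\<lparr>nvar := (nvar q)(''i'' := Suc j)\<rparr>))"
      unfolding numeral_2_eq_2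
      by (intro halts_Cond halts_Assign halts_Skip) (auto simp: agrees_def less_Suc_eq)
  qed (auto simp: agrees_def)
  then show ?thesis by simp
qed

lemma halts_Save:
  "halts Save s (2 + nvar s ''k'' * 3)
    (\<lambda>r. agrees {''e''} {''X''} s r \<and> (\<forall>x<nvar s ''k''. narr r ''X'' x = narr s ''Y'' x))"
proof -
  let ?J = "\<lambda>j r. agrees {''e''} {''X''} s r \<and> (\<forall>x<j. narr r ''X'' x = narr s ''Y'' x)"
  have "halts Save s (2 + nvar s ''k'' * (1 + 2)) (?J (nvar s ''k''))"
    unfolding Save_def
    by (intro halts_For[where J = ?J] halts_Put) (auto simp: agrees_def put_def less_Suc_eq)
  then show ?thesis
    by (rule halts_mono) auto
qed


section \<open>Correctness and running time\<close>

definition tracks :: "(nat, nat) bmst \<Rightarrow> (nat \<Rightarrow> nat) \<Rightarrow> nat set \<Rightarrow> bool" where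
  "tracks I L F \<longleftrightarrow>
     (\<forall>u\<in>verts I. \<forall>v\<in>verts I. L u = L v \<longleftrightarrow> (u, v) \<in> conn (ends I) F)"

definition loaded :: "(nat, nat) bmst \<Rightarrow> state \<Rightarrow> bool" where
  "loaded I s \<longleftrightarrow> nvar s ''n'' = card (verts I) \<and> nvar s ''k'' = card (edges I) \<and>
     nvar s ''m'' = length (follower_order I) \<and>
     (\<forall>e<card (edges I). narr s ''u'' e = Min (ends I e) \<and> narr s ''v'' e = Max (ends I e) \<and>
       narr s ''leader'' e = (if e \<in> leader_edges I then 1 else 0) \<and>
       rarr s ''c'' e = leader_cost I e) \<and>
     (\<forall>j<length (follower_order I). narr s ''order'' j = follower_order I ! j)"

lemma loaded_encode: "loaded I (bmst_encode I)"
  by (simp add: loaded_def bmst_encode_def Let_def tabulate_def)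

text \<open>\<open>t\<close>, \<open>found\<close> and \<open>best\<close> are absent, so the test
  of a threshold leaves the state of the outer loop intact.\<close>

abbreviation work_vars :: "vname set" where
  "work_vars \<equiv> {''a'', ''b'', ''i'', ''e'', ''j'', ''ok''}"

lemma loaded_agrees:
  assumes "loaded I s" "agrees xs as s r" "xs \<inter> {''n'', ''k'', ''m''} = {}"
    "as \<inter> {''u'', ''v'', ''leader'', ''order''} = {}"
  shows "loaded I r"
  using assms unfolding loaded_def agrees_def by fastforce

lemma tracks_connected:
  assumes "tracks I L F" "v \<in> verts I"
  shows "(\<forall>u\<in>verts I. L u = L v) \<longleftrightarrow> connected_by (ends I) (verts I) F"
proof -
  have "connected_by (ends I) (verts I) F \<longleftrightarrow> (\<forall>u\<in>verts I. \<forall>w\<in>verts I. L u = L w)"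
    using assms(1) by (auto simp: tracks_def connected_by_conn)
  then show ?thesis
    using assms(2) by metis
qed

section \<open>The two greedy loops and the test of one threshold\<close>

lemma cheap_forest_Suc:
  "cheap_forest I t (Suc j) =
    (if cheap I t j \<and> cycle_free (ends I) (insert j (cheap_forest I t j))
     then insert j (cheap_forest I t j) else cheap_forest I t j)"
  by (simp add: cheap_forest_def greedy_append)

context instance_on_numbers
begin

text \<open>By \<open>conn_insert_iff\<close> the new edge merges the classes of its ends, and
  relabelling merges their labels. If the labels coincide, neither side changes.\<close>

lemma tracks_relabel:
  assumes "tracks I L F" "e < k"
  shows "tracks I (relabel n (L (Min (ends I e))) (L (Max (ends I e))) L) (insert e F)"
  unfolding tracks_def
proof (intro ballI)
  fix x y
  assume xy: "x \<in> verts I" "y \<in> verts I"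
  let ?u = "Min (ends I e)" and ?v = "Max (ends I e)"
  have uv: "?u \<in> verts I" "?v \<in> verts I"
    using ends_Min_Max[OF assms(2)] vert_less by auto
  have L: "(a, b) \<in> conn (ends I) F \<longleftrightarrow> L a = L b" if "a \<in> verts I" "b \<in> verts I" for a b
    using assms(1) that by (simp add: tracks_def)
  have "x < n" "y < n"
    using xy vert_less by auto
  then show "relabel n (L ?u) (L ?v) L x = relabel n (L ?u) (L ?v) L y \<longleftrightarrow>
      (x, y) \<in> conn (ends I) (insert e F)"
    unfolding conn_insert_iff[of "ends I" e, OF ends_Min_Max(1)[OF assms(2)]] relabel_def
    using L[OF xy] L[OF xy(1) uv(1)] L[OF xy(1) uv(2)] L[OF uv(1) xy(2)] L[OF uv(2) xy(2)] by auto
qed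

text \<open>One greedy step on labels, phrased as in \<open>greedy\<close> so that it serves both
  loops: the leader's with \<open>X\<close> empty, the follower's with \<open>X\<close> the leader's
  forest.\<close>

lemma halts_Join_greedy:
  assumes "loaded I s" "nvar s ''e'' = e" "e < k" "tracks I (narr s ''lab'') (X \<union> Y)"
    "cycle_free (ends I) (X \<union> Y)" "e \<notin> X \<union> Y"
  shows "halts Join s (4 + 4 * n) (\<lambda>r. agrees {''a'', ''b'', ''i''} {''lab''} s r \<and>
    (nvar r ''a'' = nvar r ''b'' \<longleftrightarrow> \<not> cycle_free (ends I) (X \<union> Y \<union> {e})) \<and>
    tracks I (narr r ''lab'')
      (X \<union> (if cycle_free (ends I) (X \<union> Y \<union> {e}) then insert e Y else Y)))"
proof -
  let ?L = "narr s ''lab''" and ?u = "Min (ends I e)" and ?v = "Max (ends I e)"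
  have s: "nvar s ''n'' = n" "narr s ''u'' e = ?u" "narr s ''v'' e = ?v"
    using assms(1,3) by (auto simp: loaded_def)
  have "?L ?u = ?L ?v \<longleftrightarrow> (?u, ?v) \<in> conn (ends I) (X \<union> Y)"
    using assms(4) ends_Min_Max[OF assms(3)] vert_less by (simp add: tracks_def)
  then have cf: "cycle_free (ends I) (X \<union> Y \<union> {e}) \<longleftrightarrow> ?L ?u \<noteq> ?L ?v"
    using cycle_free_insert[of "ends I" _ e, OF assms(5,6) ends_Min_Max(1)[OF assms(3)]] by simp
  \<comment> \<open>On rejection the labels \<open>?L ?u\<close> and \<open>?L ?v\<close> are equal,
    so the relabelling is the identity.\<close>
  have tr: "tracks I (relabel n (?L ?u) (?L ?v) ?L)
      (X \<union> (if cycle_free (ends I) (X \<union> Y \<union> {e}) then insert e Y else Y))"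
    using tracks_relabel[OF assms(4,3)] assms(4) cf by auto
  have "halts Join s (4 + 4 * n) (\<lambda>r. agrees {''a'', ''b'', ''i''} {''lab''} s r \<and>
    nvar r ''a'' = ?L ?u \<and> nvar r ''b'' = ?L ?v \<and> narr r ''lab'' = relabel n (?L ?u) (?L ?v) ?L)"
    using halts_Join[of "?L ?u" s "?L ?v"] s assms(2) by simp
  then show ?thesis
    by (rule halts_mono) (use cf tr in auto)
qed

lemma halts_Lead:
  assumes s: "loaded I s" "nvar s ''t'' = t" "t < k" "\<forall>x<n. narr s ''lab'' x = x"
  shows "halts Lead s (2 + k * (10 + 4 * n)) (\<lambda>r. agrees work_vars {''lab'', ''Y''} s r \<and>
    tracks I (narr r ''lab'') (threshold_choice I t) \<and>
    (\<forall>e<k. narr r ''Y'' e \<noteq> 0 \<longleftrightarrow> e \<in> threshold_choice I t))"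
proof -
  let ?J = "\<lambda>j r. agrees work_vars {''lab'', ''Y''} s r \<and>
    tracks I (narr r ''lab'') (cheap_forest I t j) \<and>
    (\<forall>e<j. narr r ''Y'' e \<noteq> 0 \<longleftrightarrow> e \<in> cheap_forest I t j)"
  have "halts Lead s (2 + k * (8 + 4 * n + 2)) (?J k)"
    unfolding Lead_def
  proof (rule halts_For[where J = ?J])
    have "cheap_forest I t 0 = {}"
      by (simp add: cheap_forest_def)
    moreover have "tracks I (narr s ''lab'') {}"
      using s(4) by (auto simp: tracks_def conn_def vert_less)
    ultimately show "?J 0 (s\<lparr>nvar := (nvar s)(''e'' := 0)\<rparr>)"
      by (simp add: agrees_def)
    show "nvar r ''k'' = k" if "?J j r" for j r
      using that s(1) by (simp add: agrees_def loaded_def)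
    fix j r
    assume j: "j < k" and J: "?J j r" and e: "nvar r ''e'' = j"
    let ?r = "r\<lparr>narr := put (narr r) ''Y'' j 0\<rparr>" and ?F = "cheap_forest I t j"
    let ?Q = "\<lambda>q. nvar q ''e'' = j \<and> ?J (Suc j) (q\<lparr>nvar := (nvar q)(''e'' := Suc j)\<rparr>)"
    let ?b = "Conj (Leq (Num 1) (Get ''leader'' (Var ''e'')))
          (RLeq (RGet ''c'' (Var ''e'')) (RGet ''c'' (Var ''t'')))"
    have r: "agrees work_vars {''lab'', ''Y''} s ?r"
      using J by (auto simp: agrees_def put_def)
    then have l: "loaded I ?r"
      by (rule loaded_agrees[OF s(1)]) auto
    have "nvar ?r ''t'' = t"
      using agrees_nvar[OF r, of "''t''"] s(2) by simp
    then have b: "bval ?r ?b \<longleftrightarrow> cheap I t j"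
      using l e j s(3) by (auto simp: loaded_def cheap_def)
    have j_notin: "j \<notin> ?F"
      using cheap_forest_subset[of I t j] by auto
    have "halts (Cond ?b (Seq Join (Cond (Equal (Var ''a'') (Var ''b'')) Skip
        (Put ''Y'' (Var ''e'') (Num 1)))) Skip) ?r (Suc ((4 + 4 * n) + Suc 1)) ?Q"
    proof (rule halts_Cond)
      assume "bval ?r ?b"
      then have ch: "cheap I t j"
        using b by blast
      have "halts Join ?r (4 + 4 * n) (\<lambda>q. agrees {''a'', ''b'', ''i''} {''lab''} ?r q \<and>
        (nvar q ''a'' = nvar q ''b'' \<longleftrightarrow> \<not> cycle_free (ends I) ({} \<union> ?F \<union> {j})) \<and>
        tracks I (narr q ''lab'')
          ({} \<union> (if cycle_free (ends I) ({} \<union> ?F \<union> {j}) then insert j ?F else ?F)))"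
        using l e j J j_notin cheap_forest_cycle_free[of I t j]
        by (intro halts_Join_greedy) (auto simp: put_def)
      then show "halts (Seq Join (Cond (Equal (Var ''a'') (Var ''b'')) Skip
          (Put ''Y'' (Var ''e'') (Num 1)))) ?r (4 + 4 * n + Suc 1) ?Q"
      proof (rule halts_Seq)
        fix q
        assume q: "agrees {''a'', ''b'', ''i''} {''lab''} ?r q \<and>
          (nvar q ''a'' = nvar q ''b'' \<longleftrightarrow> \<not> cycle_free (ends I) ({} \<union> ?F \<union> {j})) \<and>
          tracks I (narr q ''lab'')
            ({} \<union> (if cycle_free (ends I) ({} \<union> ?F \<union> {j}) then insert j ?F else ?F))"
        then have sq: "agrees work_vars {''lab'', ''Y''} s q"
          by (intro agrees_trans[OF r]) auto
        have qe: "nvar q ''e'' = j" and qY: "narr q ''Y'' = (narr r ''Y'')(j := 0)"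
          using q e by (auto simp: agrees_def put_def)
        show "halts (Cond (Equal (Var ''a'') (Var ''b'')) Skip (Put ''Y'' (Var ''e'') (Num 1)))
            q (Suc 1) ?Q"
        proof (rule halts_Cond)
          assume "bval q (Equal (Var ''a'') (Var ''b''))"
          then show "halts Skip q 1 ?Q"
            using q sq qe qY J ch j_notin
            by (intro halts_Skip) (auto simp: agrees_def cheap_forest_Suc less_Suc_eq)
        next
          assume "\<not> bval q (Equal (Var ''a'') (Var ''b''))"
          then show "halts (Put ''Y'' (Var ''e'') (Num 1)) q 1 ?Q"
            using q sq qe qY J ch j_notin
            by (intro halts_Put) (auto simp: agrees_def cheap_forest_Suc less_Suc_eq put_def)
        qed
      qed
    next
      assume "\<not> bval ?r ?b"
      then have "\<not> cheap I t j"
        using b by blast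
      then show "halts Skip ?r (4 + 4 * n + Suc 1) ?Q"
        using r e J j_notin
        by (intro halts_Skip) (auto simp: agrees_def cheap_forest_Suc less_Suc_eq put_def)
    qed
    then have "halts (Seq (Put ''Y'' (Var ''e'') (Num 0)) (Cond ?b (Seq Join
        (Cond (Equal (Var ''a'') (Var ''b'')) Skip (Put ''Y'' (Var ''e'') (Num 1)))) Skip))
        r (Suc (Suc ((4 + 4 * n) + Suc 1))) ?Q"
      by (intro halts_Put_Seq) (simp add: e)
    then show "halts (Seq (Put ''Y'' (Var ''e'') (Num 0)) (Cond ?b (Seq Join
        (Cond (Equal (Var ''a'') (Var ''b'')) Skip (Put ''Y'' (Var ''e'') (Num 1)))) Skip))
        r (8 + 4 * n) ?Q"
      by (rule halts_mono) auto
  qed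
  then show ?thesis
    by (simp add: algebra_simps)
qed

lemma halts_Follow:
  assumes s: "loaded I s" "nvar s ''t'' = t" "t < k" "tracks I (narr s ''lab'') X"
    and X: "cycle_free (ends I) X" "X \<subseteq> leader_edges I"
  shows "halts Follow s (2 + m * (10 + 4 * n)) (\<lambda>r. agrees work_vars {''lab''} s r \<and>
    tracks I (narr r ''lab'') (X \<union> response I X) \<and>
    (nvar r ''ok'' \<noteq> 0 \<longleftrightarrow>
      nvar s ''ok'' \<noteq> 0 \<and> (\<forall>e\<in>response I X. leader_cost I e \<le> leader_cost I t)))"
proof -
  \<comment> \<open>The follower's edges accepted among the first \<open>j\<close> of the
    order.\<close>
  define Y where "Y j = greedy (ends I) X (take j (follower_order I)) {}" for j
  let ?J = "\<lambda>j r. agrees work_vars {''lab''} s r \<and> tracks I (narr r ''lab'') (X \<union> Y j) \<and>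
    (nvar r ''ok'' \<noteq> 0 \<longleftrightarrow>
      nvar s ''ok'' \<noteq> 0 \<and> (\<forall>e\<in>Y j. leader_cost I e \<le> leader_cost I t))"
  have "halts Follow s (2 + m * (8 + 4 * n + 2)) (?J m)"
    unfolding Follow_def
  proof (rule halts_For[where J = ?J])
    show "?J 0 (s\<lparr>nvar := (nvar s)(''j'' := 0)\<rparr>)"
      using s(4) by (simp add: agrees_def Y_def)
    show "nvar r ''m'' = m" if "?J j r" for j r
      using that s(1) by (simp add: agrees_def loaded_def)
    fix j r
    assume j: "j < m" and J: "?J j r" and rj: "nvar r ''j'' = j"
    define e where "e = follower_order I ! j"
    let ?r = "r\<lparr>nvar := (nvar r)(''e'' := e)\<rparr>"
    let ?Q = "\<lambda>q. nvar q ''j'' = j \<and> ?J (Suc j) (q\<lparr>nvar := (nvar q)(''j'' := Suc j)\<rparr>)"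
    let ?b = "RLeq (RGet ''c'' (Var ''e'')) (RGet ''c'' (Var ''t''))"
    let ?c = "cycle_free (ends I) (X \<union> Y j \<union> {e})"
    have e: "e < k" "e \<in> follower_edges I"
      using j order_less order(2) nth_mem by (auto simp: e_def)
    have Y_Suc: "Y (Suc j) = (if ?c then insert e (Y j) else Y j)"
      using j by (simp add: Y_def e_def take_Suc_conv_app_nth greedy_append)
    \<comment> \<open>The order has no repetitions, and follower's edges are not leader's edges; so
      \<open>e\<close> is new and the connectivity criterion applies.\<close>
    have "e \<notin> set (take j (follower_order I))"
      using j order(1) by (auto simp: e_def in_set_conv_nth nth_eq_iff_index_eq)
    then have e_notin: "e \<notin> X \<union> Y j"
      using X(2) disjoint e greedy_subset[of "ends I" X "take j (follower_order I)" "{}"]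
      by (auto simp: Y_def)
    have cf: "cycle_free (ends I) (X \<union> Y j)"
      unfolding Y_def using X by (intro greedy_cycle_free) simp
    have r: "agrees work_vars {''lab''} s ?r"
      using J by (auto simp: agrees_def)
    then have l: "loaded I ?r"
      by (rule loaded_agrees[OF s(1)]) auto
    have "loaded I r"
      using J by (intro loaded_agrees[OF s(1)]) auto
    then have re: "nval r (Get ''order'' (Var ''j'')) = e"
      using j rj by (simp add: loaded_def e_def)
    have "halts Join ?r (4 + 4 * n) (\<lambda>q. agrees {''a'', ''b'', ''i''} {''lab''} ?r q \<and>
      (nvar q ''a'' = nvar q ''b'' \<longleftrightarrow> \<not> ?c) \<and>
      tracks I (narr q ''lab'') (X \<union> (if ?c then insert e (Y j) else Y j)))"
      using l e J e_notin cf by (intro halts_Join_greedy) auto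
    then have "halts (Seq Join (Cond (Equal (Var ''a'') (Var ''b'')) Skip
        (Cond ?b Skip (Assign ''ok'' (Num 0))))) ?r (4 + 4 * n + Suc (Suc 1)) ?Q"
    proof (rule halts_Seq)
      fix q
      assume q: "agrees {''a'', ''b'', ''i''} {''lab''} ?r q \<and>
        (nvar q ''a'' = nvar q ''b'' \<longleftrightarrow> \<not> ?c) \<and>
        tracks I (narr q ''lab'') (X \<union> (if ?c then insert e (Y j) else Y j))"
      then have sq: "agrees work_vars {''lab''} s q"
        by (intro agrees_trans[OF r]) auto
      then have lq: "loaded I q"
        by (rule loaded_agrees[OF s(1)]) auto
      have qv: "nvar q ''e'' = e" "nvar q ''j'' = j" "nvar q ''ok'' = nvar r ''ok''"
        using q rj by (auto simp: agrees_def)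
      have qt: "nvar q ''t'' = t"
        using agrees_nvar[OF sq, of "''t''"] s(2) by simp
      have b: "bval q ?b \<longleftrightarrow> leader_cost I e \<le> leader_cost I t"
        using lq qv qt e s(3) by (simp add: loaded_def)
      have sq': "agrees work_vars {''lab''} s (q\<lparr>nvar := (nvar q)(''j'' := Suc j)\<rparr>)"
        "agrees work_vars {''lab''} s (q\<lparr>nvar := (nvar q)(''ok'' := 0, ''j'' := Suc j)\<rparr>)"
        using sq by (auto simp: agrees_def)
      show "halts (Cond (Equal (Var ''a'') (Var ''b'')) Skip (Cond ?b Skip
          (Assign ''ok'' (Num 0)))) q (Suc (Suc 1)) ?Q"
      proof (intro halts_Cond)
        assume "bval q (Equal (Var ''a'') (Var ''b''))"
        then show "halts Skip q (Suc 1) ?Q"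
          using q sq' qv J by (intro halts_Skip) (auto simp: Y_Suc)
      next
        assume "\<not> bval q (Equal (Var ''a'') (Var ''b''))" "bval q ?b"
        then show "halts Skip q 1 ?Q"
          using q sq' qv J b by (intro halts_Skip) (auto simp: Y_Suc)
      next
        assume "\<not> bval q (Equal (Var ''a'') (Var ''b''))" "\<not> bval q ?b"
        then show "halts (Assign ''ok'' (Num 0)) q 1 ?Q"
          using q sq' qv J b by (intro halts_Assign) (auto simp: Y_Suc)
      qed
    qed
    then have "halts (Seq (Assign ''e'' (Get ''order'' (Var ''j''))) (Seq Join
        (Cond (Equal (Var ''a'') (Var ''b'')) Skip (Cond ?b Skip (Assign ''ok'' (Num 0))))))
        r (Suc (4 + 4 * n + Suc (Suc 1))) ?Q"
      by (intro halts_Assign_Seq) (simp only: re)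
    then show "halts (Seq (Assign ''e'' (Get ''order'' (Var ''j''))) (Seq Join
        (Cond (Equal (Var ''a'') (Var ''b'')) Skip (Cond ?b Skip (Assign ''ok'' (Num 0))))))
        r (8 + 4 * n) ?Q"
      by (rule halts_mono) auto
  qed
  moreover have "Y m = response I X"
    by (simp add: Y_def response_def)
  ultimately show ?thesis
    by (simp add: algebra_simps)
qed

text \<open>The constant 9 is 2 for each of the four loops and 1 for setting \<open>ok\<close>;
  \<open>7 * n\<close> is 3 per vertex for \<open>Init\<close> and 4 for
  \<open>Check\<close>.\<close>

definition "test_time = 9 + 7 * n + k * (10 + 4 * n) + m * (10 + 4 * n)"

lemma halts_Test:
  assumes s: "loaded I s" "nvar s ''t'' = t" "t < k"
  shows "halts Test s test_time (\<lambda>r. agrees work_vars {''lab'', ''Y''} s r \<and>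
    (nvar r ''ok'' \<noteq> 0 \<longleftrightarrow> achievable I t) \<and>
    (\<forall>e<k. narr r ''Y'' e \<noteq> 0 \<longleftrightarrow> e \<in> threshold_choice I t))"
    (is "halts _ _ _ ?Q")
proof -
  let ?X = "threshold_choice I t"
  have n: "nvar r ''n'' = n" if "loaded I r" for r
    using that by (simp add: loaded_def)
  have "halts Test s ((2 + nvar s ''n'' * 3) +
      ((2 + k * (10 + 4 * n)) + Suc ((2 + m * (10 + 4 * n)) + (2 + n * 4)))) ?Q"
    unfolding Test_def
  proof (rule halts_Seq[OF halts_Init])
    fix r1
    assume r1: "agrees {''i''} {''lab''} s r1 \<and> (\<forall>x<nvar s ''n''. narr r1 ''lab'' x = x)"
    have l1: "loaded I r1"
      using r1 by (intro loaded_agrees[OF s(1)]) auto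
    have "halts Lead r1 (2 + k * (10 + 4 * n)) (\<lambda>r. agrees work_vars {''lab'', ''Y''} r1 r \<and>
        tracks I (narr r ''lab'') ?X \<and> (\<forall>e<k. narr r ''Y'' e \<noteq> 0 \<longleftrightarrow> e \<in> ?X))"
      using r1 s n[OF s(1)] by (intro halts_Lead l1) (auto simp: agrees_def)
    then show "halts (Seq Lead (Seq (Assign ''ok'' (Num 1)) (Seq Follow Check))) r1
        ((2 + k * (10 + 4 * n)) + Suc ((2 + m * (10 + 4 * n)) + (2 + n * 4))) ?Q"
    proof (rule halts_Seq)
      fix r2
      assume r2: "agrees work_vars {''lab'', ''Y''} r1 r2 \<and>
        tracks I (narr r2 ''lab'') ?X \<and> (\<forall>e<k. narr r2 ''Y'' e \<noteq> 0 \<longleftrightarrow> e \<in> ?X)"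
      let ?r = "r2\<lparr>nvar := (nvar r2)(''ok'' := 1)\<rparr>"
      have a: "agrees work_vars {''lab'', ''Y''} s ?r"
        using r1 r2 by (auto simp: agrees_def)
      then have l: "loaded I ?r"
        by (rule loaded_agrees[OF s(1)]) auto
      have "nvar ?r ''t'' = t"
        using agrees_nvar[OF a, of "''t''"] s(2) by simp
      then have "halts Follow ?r (2 + m * (10 + 4 * n)) (\<lambda>r. agrees work_vars {''lab''} ?r r \<and>
          tracks I (narr r ''lab'') (?X \<union> response I ?X) \<and>
          (nvar r ''ok'' \<noteq> 0 \<longleftrightarrow>
            nvar ?r ''ok'' \<noteq> 0 \<and> (\<forall>e\<in>response I ?X. leader_cost I e \<le> leader_cost I t)))"
        using r2 s(3) l
        by (intro halts_Follow cheap_forest_cycle_free cheap_forest_leader) auto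
      then have "halts (Seq Follow Check) ?r ((2 + m * (10 + 4 * n)) + (2 + n * 4)) ?Q"
      proof (rule halts_Seq)
        fix r3
        assume r3: "agrees work_vars {''lab''} ?r r3 \<and>
          tracks I (narr r3 ''lab'') (?X \<union> response I ?X) \<and>
          (nvar r3 ''ok'' \<noteq> 0 \<longleftrightarrow>
            nvar ?r ''ok'' \<noteq> 0 \<and> (\<forall>e\<in>response I ?X. leader_cost I e \<le> leader_cost I t))"
        then have a3: "agrees work_vars {''lab'', ''Y''} s r3"
          by (intro agrees_trans[OF a]) auto
        then have l3: "loaded I r3"
          by (rule loaded_agrees[OF s(1)]) auto
        \<comment> \<open>The labels describe the tree, while \<open>achievable\<close> speaks of
          all follower's edges; \<open>response_conn\<close> bridges the two.\<close>
        have "(\<forall>u\<in>verts I. narr r3 ''lab'' u = narr r3 ''lab'' 0) \<longleftrightarrow>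
            connected_by (ends I) (verts I) (?X \<union> response I ?X)"
          using r3 n_pos vert_less by (intro tracks_connected) auto
        also have "\<dots> \<longleftrightarrow> connected_by (ends I) (verts I) (?X \<union> follower_edges I)"
          unfolding connected_by_conn
          using response_conn[OF cheap_forest_cycle_free cheap_forest_leader] by simp
        finally have con: "(\<forall>x<n. narr r3 ''lab'' x = narr r3 ''lab'' 0) \<longleftrightarrow>
            connected_by (ends I) (verts I) (?X \<union> follower_edges I)"
          by (simp add: vert_less Ball_def)
        have Y: "narr r3 ''Y'' = narr r2 ''Y''"
          using r3 by (auto simp: agrees_def)
        from halts_Check[of r3] show "halts Check r3 (2 + n * 4) ?Q"
          unfolding n[OF l3]
        proof (rule halts_mono)
          fix r
          assume r: "agrees {''i'', ''ok''} {} r3 r \<and> (nvar r ''ok'' \<noteq> 0 \<longleftrightarrow>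
            nvar r3 ''ok'' \<noteq> 0 \<and> (\<forall>x<n. narr r3 ''lab'' x = narr r3 ''lab'' 0))"
          have "agrees work_vars {''lab'', ''Y''} s r"
            using r by (intro agrees_trans[OF a3]) auto
          moreover have "nvar r ''ok'' \<noteq> 0 \<longleftrightarrow> achievable I t"
            using r r3 con by (simp add: achievable_def)
          moreover have "narr r ''Y'' = narr r2 ''Y''"
            using r Y by (simp add: agrees_def)
          ultimately show "?Q r"
            using r2 by simp
        qed simp
      qed
      then show "halts (Seq (Assign ''ok'' (Num 1)) (Seq Follow Check)) r2
          (Suc ((2 + m * (10 + 4 * n)) + (2 + n * 4))) ?Q"
        by (intro halts_Assign_Seq) simp
    qed
  qed
  then show ?thesis
    by (rule halts_mono) (simp_all add: n[OF s(1)] test_time_def)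
qed

section \<open>The search over all thresholds\<close>

lemma halts_Solve:
  "halts Solve (bmst_encode I) (2 + k * (test_time + 7 + 3 * k))
    (\<lambda>r. optimal_choice I (bmst_decode I r))"
proof -
  \<comment> \<open>\<open>best\<close> is a cheapest achievable threshold below \<open>j\<close>
    and \<open>X\<close> holds its forest; while \<open>found\<close> is 0, no threshold below
    \<open>j\<close> is achievable.\<close>
  let ?J = "\<lambda>j r. loaded I r \<and>
    (if nvar r ''found'' = 0 then \<forall>t<j. \<not> achievable I t
     else nvar r ''best'' < k \<and> achievable I (nvar r ''best'') \<and>
       (\<forall>t<j. achievable I t \<longrightarrow> leader_cost I (nvar r ''best'') \<le> leader_cost I t) \<and>
       (\<forall>e<k. narr r ''X'' e \<noteq> 0 \<longleftrightarrow> e \<in> threshold_choice I (nvar r ''best'')))"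
  have "halts Solve (bmst_encode I) (2 + k * (test_time + Suc (4 + 3 * k) + 2)) (?J k)"
    unfolding Solve_def
  proof (rule halts_For[where J = ?J])
    have "nvar (bmst_encode I) ''found'' = 0"
      by (simp add: bmst_encode_def Let_def)
    moreover have "loaded I ((bmst_encode I)\<lparr>nvar := (nvar (bmst_encode I))(''t'' := 0)\<rparr>)"
      by (rule loaded_agrees[OF loaded_encode, of "{''t''}" "{}"]) (auto simp: agrees_def)
    ultimately show "?J 0 ((bmst_encode I)\<lparr>nvar := (nvar (bmst_encode I))(''t'' := 0)\<rparr>)"
      by simp
    show "nvar r ''k'' = k" if "?J j r" for j r
      using that by (simp add: loaded_def)
    fix j r
    assume j: "j < k" and J: "?J j r" and t: "nvar r ''t'' = j"
    let ?Q = "\<lambda>q. nvar q ''t'' = j \<and> ?J (Suc j) (q\<lparr>nvar := (nvar q)(''t'' := Suc j)\<rparr>)"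
    let ?b = "Conj (Leq (Num 1) (Var ''ok''))
          (Neg (Conj (Leq (Num 1) (Var ''found''))
            (RLeq (RGet ''c'' (Var ''best'')) (RGet ''c'' (Var ''t'')))))"
    let ?p = "Seq (Assign ''found'' (Num 1)) (Seq (Assign ''best'' (Var ''t'')) Save)"
    have "halts Test r test_time (\<lambda>q. agrees work_vars {''lab'', ''Y''} r q \<and>
        (nvar q ''ok'' \<noteq> 0 \<longleftrightarrow> achievable I j) \<and>
        (\<forall>e<k. narr q ''Y'' e \<noteq> 0 \<longleftrightarrow> e \<in> threshold_choice I j))"
      by (rule halts_Test[OF conjunct1[OF J] t j])
    then show "halts (Seq Test (Cond ?b ?p Skip)) r (test_time + Suc (4 + 3 * k)) ?Q"
    proof (rule halts_Seq)
      fix q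
      assume q: "agrees work_vars {''lab'', ''Y''} r q \<and>
        (nvar q ''ok'' \<noteq> 0 \<longleftrightarrow> achievable I j) \<and>
        (\<forall>e<k. narr q ''Y'' e \<noteq> 0 \<longleftrightarrow> e \<in> threshold_choice I j)"
      have l: "loaded I q"
        by (rule loaded_agrees[OF conjunct1[OF J] conjunct1[OF q]]) auto
      have v: "nvar q ''t'' = j" "nvar q ''found'' = nvar r ''found''"
        "nvar q ''best'' = nvar r ''best''" "narr q ''X'' = narr r ''X''"
        using conjunct1[OF q] t by (auto simp: agrees_def)
      have c: "rarr q ''c'' j = leader_cost I j"
        using l j by (simp add: loaded_def)
      have c_best: "rarr q ''c'' (nvar r ''best'') = leader_cost I (nvar r ''best'')"
        if "nvar r ''found'' \<noteq> 0"
        using that J l by (simp add: loaded_def)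
      have b: "bval q ?b \<longleftrightarrow> achievable I j \<and>
          (nvar r ''found'' = 0 \<or> leader_cost I j < leader_cost I (nvar r ''best''))"
        using conjunct1[OF conjunct2[OF q]] v c c_best
        by (cases "nvar r ''found'' = 0") (auto simp: not_le Suc_le_eq)
      show "halts (Cond ?b ?p Skip) q (Suc (4 + 3 * k)) ?Q"
      proof (rule halts_Cond)
        assume "bval q ?b"
        then have new: "achievable I j"
          "nvar r ''found'' = 0 \<or> leader_cost I j < leader_cost I (nvar r ''best'')"
          using b by blast+
        \<comment> \<open>Either no earlier threshold is achievable, or \<open>j\<close> beats the
          old best, which was least so far.\<close>
        have least: "\<forall>t<Suc j. achievable I t \<longrightarrow> leader_cost I j \<le> leader_cost I t"
          using new J by (force simp: less_Suc_eq split: if_splits)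
        let ?q = "q\<lparr>nvar := (nvar q)(''found'' := 1, ''best'' := j)\<rparr>"
        have lq: "loaded I ?q"
          by (rule loaded_agrees[OF l, of "{''found'', ''best''}" "{}"]) (auto simp: agrees_def)
        then have k: "nvar ?q ''k'' = k"
          by (simp add: loaded_def)
        have "halts Save ?q (2 + k * 3) ?Q"
          using halts_Save[of ?q] unfolding k
        proof (rule halts_mono)
          fix z
          assume z: "agrees {''e''} {''X''} ?q z \<and> (\<forall>x<k. narr z ''X'' x = narr ?q ''Y'' x)"
          let ?z = "z\<lparr>nvar := (nvar z)(''t'' := Suc j)\<rparr>"
          have "loaded I ?z"
            using z by (intro loaded_agrees[OF lq, of "{''e'', ''t''}" "{''X''}"])
              (auto simp: agrees_def)
          moreover have "nvar z ''t'' = j" "nvar z ''found'' = 1" "nvar z ''best'' = j"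
            "\<forall>e<k. narr z ''X'' e \<noteq> 0 \<longleftrightarrow> e \<in> threshold_choice I j"
            using z v q by (auto simp: agrees_def)
          ultimately show "?Q z"
            using least new(1) j by simp
        qed simp
        then have "halts ?p q (Suc (Suc (2 + k * 3))) ?Q"
          using v(1) by (intro halts_Assign_Seq) simp
        then show "halts ?p q (4 + 3 * k) ?Q"
          by (rule halts_mono) auto
      next
        assume "\<not> bval q ?b"
        then have old: "\<not> achievable I j \<or>
            nvar r ''found'' \<noteq> 0 \<and> leader_cost I (nvar r ''best'') \<le> leader_cost I j"
          unfolding b by (simp add: not_less)
        have "loaded I (q\<lparr>nvar := (nvar q)(''t'' := Suc j)\<rparr>)"
          by (rule loaded_agrees[OF l, of "{''t''}" "{}"]) (auto simp: agrees_def)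
        then show "halts Skip q (4 + 3 * k) ?Q"
          using J v old by (intro halts_Skip) (auto simp: less_Suc_eq split: if_splits)
      qed
    qed
  qed
  then show ?thesis
  proof (rule halts_mono)
    fix r
    assume J: "?J k r"
    show "optimal_choice I (bmst_decode I r)"
    \<comment> \<open>Without edges the decoded set is empty. Otherwise some threshold is
      achievable, so the loop cannot end with \<open>found\<close> equal to 0.\<close>
    proof (cases "k = 0")
      case True
      then have "bmst_decode I r = {}"
        by (simp add: bmst_decode_def edge_less)
      then show ?thesis
        using optimal_empty[OF True] by simp
    next
      case False
      then have f: "nvar r ''found'' \<noteq> 0"
        using achievable_exists J by (auto split: if_splits)
      have "bmst_decode I r = threshold_choice I (nvar r ''best'')"
        using J f cheap_forest_subset[of I "nvar r ''best''" k]
        by (auto simp: bmst_decode_def edge_less)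
      then show ?thesis
        using J f by (auto intro!: optimal_threshold_choice)
    qed
  qed simp
qed

text \<open>Using \<open>m \<le> k\<close>, the body of the search costs at most
  \<open>16 + 7 * n + 23 * k + 8 * (k * n)\<close>, where 16 is 9 + 7, 23 is 10 + 10 + 3 and 8 is 4
  + 4. Bounding \<open>n\<close> and \<open>k\<close> by the input size and multiplying by at most
  that size shifts the coefficients by one degree; the final 2 is the loop overhead.\<close>

lemma solve_time: "2 + k * (test_time + 7 + 3 * k) \<le> poly [:2, 16, 23, 8:] (bmst_size I)"
proof -
  define z where "z = n + k"
  have "m * (10 + 4 * n) \<le> k * (10 + 4 * n)"
    using m_le_k by (rule mult_right_mono) simp
  then have "test_time + 7 + 3 * k \<le> 16 + 7 * n + 23 * k + 8 * (k * n)"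
    by (simp add: test_time_def algebra_simps)
  moreover have "k * n \<le> z * z"
    by (intro mult_mono) (auto simp: z_def)
  moreover have "7 * n + 23 * k \<le> 23 * z"
    by (simp add: z_def)
  ultimately have "test_time + 7 + 3 * k \<le> 16 + 23 * z + 8 * (z * z)"
    by linarith
  then have "k * (test_time + 7 + 3 * k) \<le> z * (16 + 23 * z + 8 * (z * z))"
    by (intro mult_mono) (auto simp: z_def)
  then show ?thesis
    unfolding z_def by (simp add: bmst_size_def algebra_simps)
qed

end

theorem theorem9:
  "polynomial_time_solvable bmst_inputs bmst_size bmst_encode bmst_decode optimal_choice"
  unfolding polynomial_time_solvable_def
proof (rule exI[of _ Solve], rule exI[of _ "[:2, 16, 23, 8:]"], rule ballI)
  fix I :: "(nat, nat) bmst"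
  assume "I \<in> bmst_inputs"
  then interpret instance_on_numbers I
    by (rule instance_on_numbers.intro)
  obtain t s where "runs Solve (bmst_encode I) t s"
    "t \<le> 2 + card (edges I) * (test_time + 7 + 3 * card (edges I))"
    "optimal_choice I (bmst_decode I s)"
    using halts_Solve unfolding halts_def by blast
  then show "\<exists>t s. runs Solve (bmst_encode I) t s \<and> t \<le> poly [:2, 16, 23, 8:] (bmst_size I) \<and>
      optimal_choice I (bmst_decode I s)"
    using solve_time le_trans by blast
qed

end
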